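(* Let $E$ be a locally complete lcHs over $\mathbb{K}$, $G\subset E'$ a separating subspace and let $F(\Omega)$ and $F(\Omega,E)$ be $\varepsilon$-into-compatible. Let $(T^{E},T^{\mathbb{K}})$ be a generator for $(\mathcal{F}\nu,E)$ and a strong, consistent family for $(F,E)$, let $\mathcal{F}\nu(\Omega)$ be a Banach space whose closed unit ball $B_{\mathcal{F}\nu(\Omega)}$ is a compact subset of $F(\Omega)$, and let $U$ fix the topology in $\mathcal{F}\nu(\Omega)$. Then the restriction map \[ R_{U,G}\colon\mathcal{F}_{\varepsilon}\nu(\Omega,E)\to\mathcal{F}\nu_{G}(U,E)_{lb},\; f\mapsto(T^{E}(f)(x))_{x\in U}, \] is surjective.
   Context: $\mathbb{K}=\mathbb{R}$ or $\mathbb{C}$. An lcHs is a non-trivial locally convex Hausdorff space over $\mathbb{K}$; the topology of $E$ is given by a directed system of seminorms $(p_\alpha)_{\alpha\in\mathfrak{A}}$ (for $E=\mathbb{K}$: $\{|\cdot|\}$). For an lcHs $X$, $X'_{\kappa}$ is $X'$ with the topology of uniform convergence on absolutely convex compact subsets of $X$, and $X\varepsilon E:=L_{e}(X'_{\kappa},E)$ carries the topology of uniform convergence on equicontinuous subsets of $X'$. $\delta_x(f):=f(x)$. $E$ is locally complete if for every closed bounded absolutely convex $D\subset E$ the space $E_D:=\bigcup_n nD$, normed by the gauge of $D$, is a Banach space. $G\subset E'$ is separating if $e'(x)=0$ for all $e'\in G$ implies $x=0$. Setting: $\Omega,\omega$ are non-empty sets, $\nu\colon\omega\to(0,\infty)$.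 For $Y\in\{\mathbb{K},E\}$, $T^{Y}\colon Y^{\Omega}\supset\operatorname{dom}T^{Y}\to Y^{\omega}$ is linear, $\operatorname{AP}(\Omega,Y)\subset Y^{\Omega}$ is a linear subspace, $F(\Omega,Y)=\operatorname{AP}(\Omega,Y)\cap\operatorname{dom}T^{Y}$ (and $F(\Omega)=F(\Omega,\mathbb{K})$) is equipped with some locally convex Hausdorff topology, with $\delta_x\in F(\Omega)'$ for all $x\in\Omega$, and \[ \mathcal{F}\nu(\Omega,Y)=\{f\in F(\Omega,Y)\;|\;\forall\alpha:\ |f|_{\alpha}:=\sup_{x\in\omega}p_\alpha(T^{Y}(f)(x))\nu(x)<\infty\} \] carries the topology of the seminorms $|\cdot|_\alpha$; $\mathcal{F}\nu(\Omega)=\mathcal{F}\nu(\Omega,\mathbb{K})$ with norm $|\cdot|_{\mathcal{F}\nu(\Omega)}$. $(T^{E},T^{\mathbb{K}})$ is a generator for $(\mathcal{F}\nu,E)$ if $\mathcal{F}\nu(\Omega)$ and $\mathcal{F}\nu(\Omega,E)$ are Hausdorff (with directed systems of seminorms) and $\delta_x\in\mathcal{F}\nu(\Omega)'$ for all $x\in\Omega$. Put $T^{\mathbb{K}}_x:=\delta_x\circ T^{\mathbb{K}}$, $x\in\omega$. $F(\Omega)$ and $F(\Omega,E)$ are $\varepsilon$-into-compatible if $S\colon F(\Omega)\varepsilon E\to F(\Omega,E)$, $u\mapsto[x\mapsto u(\delta_x)]$, is a well-defined topological isomorphism onto its range. $(T^{E},T^{\mathbb{K}})$ is consistent for $(F,E)$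 if for all $u\in F(\Omega)\varepsilon E$, $x\in\omega$: $S(u)\in F(\Omega,E)$, $T^{\mathbb{K}}_x\in F(\Omega)'$, $T^{E}(S(u))(x)=u(T^{\mathbb{K}}_x)$; strong if for all $e'\in E'$, $f\in F(\Omega,E)$, $x\in\omega$: $e'\circ f\in F(\Omega)$ and $T^{\mathbb{K}}(e'\circ f)(x)=e'(T^{E}(f)(x))$. $\mathcal{F}_{\varepsilon}\nu(\Omega,E):=S(\{u\in F(\Omega)\varepsilon E\;|\;u(B^{\circ})\text{ is bounded in }E\})$ where $B^{\circ}:=\{y'\in F(\Omega)'\;|\;\forall f\in B_{\mathcal{F}\nu(\Omega)}:\ |y'(f)|\le1\}$. $U\subset\omega$ fixes the topology in $\mathcal{F}\nu(\Omega)$ if there is $C>0$ with $|f|_{\mathcal{F}\nu(\Omega)}\le C\sup_{x\in U}|T^{\mathbb{K}}(f)(x)|\nu(x)$ for all $f\in\mathcal{F}\nu(\Omega)$. $\mathcal{F}\nu_{G}(U,E)$ is the space of functions $f\colon U\to E$ such that for every $e'\in G$ there is $f_{e'}\in\mathcal{F}\nu(\Omega)$ with $T^{\mathbb{K}}(f_{e'})(x)=(e'\circ f)(x)$ for all $x\in U$; $\mathcal{F}\nu_{G}(U,E)_{lb}$ consists of those $f\in\mathcal{F}\nu_{G}(U,E)$ for which $\{f(x)\nu(x)\;|\;x\in U\}$ is bounded in $E$. *)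

theory Defs
  imports "HOL-Analysis.Analysis" "HOL-Library.Function_Algebras"
begin

section \<open>The scalar field\<close>

text \<open>
  The class of normed fields that are isometrically isomorphic to the real or to the complex
  numbers. A theorem about an arbitrary type of this class covers both cases.
\<close>

class real_or_complex = real_normed_field +
  assumes ex_iso_real_or_complex:
    "\<exists>\<phi> :: 'a \<Rightarrow> complex.
       (\<forall>x y. \<phi> (x + y) = \<phi> x + \<phi> y) \<and> (\<forall>x y. \<phi> (x * y) = \<phi> x * \<phi> y) \<and> \<phi> 1 = 1 \<and>
       (\<forall>r x. \<phi> (r *\<^sub>R x) = r *\<^sub>R \<phi> x) \<and> (\<forall>x. norm (\<phi> x) = norm x) \<and>
       (range \<phi> = \<real> \<or> range \<phi> = UNIV)"

instance real :: real_or_complex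
proof
  show "\<exists>\<phi> :: real \<Rightarrow> complex.
       (\<forall>x y. \<phi> (x + y) = \<phi> x + \<phi> y) \<and> (\<forall>x y. \<phi> (x * y) = \<phi> x * \<phi> y) \<and> \<phi> 1 = 1 \<and>
       (\<forall>r x. \<phi> (r *\<^sub>R x) = r *\<^sub>R \<phi> x) \<and> (\<forall>x. norm (\<phi> x) = norm x) \<and>
       (range \<phi> = \<real> \<or> range \<phi> = UNIV)"
    by (rule exI[of _ complex_of_real]) (auto simp: Reals_def scaleR_conv_of_real)
qed

instance complex :: real_or_complex
proof
  show "\<exists>\<phi> :: complex \<Rightarrow> complex.
       (\<forall>x y. \<phi> (x + y) = \<phi> x + \<phi> y) \<and> (\<forall>x y. \<phi> (x * y) = \<phi> x * \<phi> y) \<and> \<phi> 1 = 1 \<and>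
       (\<forall>r x. \<phi> (r *\<^sub>R x) = r *\<^sub>R \<phi> x) \<and> (\<forall>x. norm (\<phi> x) = norm x) \<and>
       (range \<phi> = \<real> \<or> range \<phi> = UNIV)"
    by (rule exI[of _ "\<lambda>z. z"]) auto
qed

section \<open>Locally convex spaces\<close>

text \<open>
  There is no type class for complex vector spaces, so the scalar multiplication is an explicit
  argument \<open>s\<close>, as in the library locale \<^locale>\<open>vector_space\<close>. Spaces of functions are linear
  subspaces of a function type (with the pointwise operations) and are represented by their
  carrier \<open>V\<close>; a topology on such a space is a value of type \<^typ>\<open>'v topology\<close> whose
  \<^const>\<open>topspace\<close> is the carrier.
\<close>

definition pointwise :: "('k \<Rightarrow> 'y \<Rightarrow> 'y) \<Rightarrow> 'k \<Rightarrow> ('x \<Rightarrow> 'y) \<Rightarrow> ('x \<Rightarrow> 'y)" where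
  "pointwise s = (\<lambda>a f x. s a (f x))"

definition linear_map_on ::
  "('k::field \<Rightarrow> 'v::ab_group_add \<Rightarrow> 'v) \<Rightarrow> ('k \<Rightarrow> 'w::ab_group_add \<Rightarrow> 'w) \<Rightarrow>
   'v set \<Rightarrow> ('v \<Rightarrow> 'w) \<Rightarrow> bool" where
  "linear_map_on s t V f \<longleftrightarrow> module.subspace s V \<and>
     (\<forall>x\<in>V. \<forall>y\<in>V. f (x + y) = f x + f y) \<and> (\<forall>a. \<forall>x\<in>V. f (s a x) = t a (f x))"

definition seminorm_on ::
  "('k::real_normed_field \<Rightarrow> 'v::ab_group_add \<Rightarrow> 'v) \<Rightarrow> 'v set \<Rightarrow> ('v \<Rightarrow> real) \<Rightarrow> bool" where
  "seminorm_on s V q \<longleftrightarrow> (\<forall>x\<in>V. 0 \<le> q x) \<and> (\<forall>x\<in>V. \<forall>y\<in>V. q (x + y) \<le> q x + q y) \<and>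
     (\<forall>a. \<forall>x\<in>V. q (s a x) = norm a * q x)"

definition directed_seminorms ::
  "('k::real_normed_field \<Rightarrow> 'v::ab_group_add \<Rightarrow> 'v) \<Rightarrow> 'v set \<Rightarrow> ('v \<Rightarrow> real) set \<Rightarrow> bool" where
  "directed_seminorms s V P \<longleftrightarrow> P \<noteq> {} \<and> (\<forall>q\<in>P. seminorm_on s V q) \<and>
     (\<forall>q1\<in>P. \<forall>q2\<in>P. \<exists>q\<in>P. \<exists>C>0. \<forall>x\<in>V. max (q1 x) (q2 x) \<le> C * q x)"

definition seminorm_topology :: "'v::ab_group_add set \<Rightarrow> ('v \<Rightarrow> real) set \<Rightarrow> 'v topology" where
  "seminorm_topology V P =
     topology_generated_by {{y \<in> V. q (y - x) < r} | q x r. q \<in> P \<and> x \<in> V \<and> 0 < r}"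

definition locally_convex_Hausdorff ::
  "('k::real_normed_field \<Rightarrow> 'v::ab_group_add \<Rightarrow> 'v) \<Rightarrow> 'v set \<Rightarrow> 'v topology \<Rightarrow> bool" where
  "locally_convex_Hausdorff s V X \<longleftrightarrow> module.subspace s V \<and>
     (\<exists>P. directed_seminorms s V P \<and> X = seminorm_topology V P) \<and> Hausdorff_space X"

text \<open>A non-trivial locally convex Hausdorff space on a whole type with a chosen system \<open>P\<close>.\<close>

definition lcHs ::
  "('k::real_normed_field \<Rightarrow> 'e::ab_group_add \<Rightarrow> 'e) \<Rightarrow> ('e \<Rightarrow> real) set \<Rightarrow> bool" where
  "lcHs s P \<longleftrightarrow> vector_space s \<and> (\<exists>x::'e. x \<noteq> 0) \<and> directed_seminorms s UNIV P \<and>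
     Hausdorff_space (seminorm_topology UNIV P)"

definition bounded_wrt :: "('v \<Rightarrow> real) set \<Rightarrow> 'v set \<Rightarrow> bool" where
  "bounded_wrt P D \<longleftrightarrow> (\<forall>q\<in>P. \<exists>M. \<forall>x\<in>D. q x \<le> M)"

definition absolutely_convex ::
  "('k::real_normed_field \<Rightarrow> 'v::ab_group_add \<Rightarrow> 'v) \<Rightarrow> 'v set \<Rightarrow> bool" where
  "absolutely_convex s D \<longleftrightarrow>
     (\<forall>x\<in>D. \<forall>y\<in>D. \<forall>a b. norm a + norm b \<le> 1 \<longrightarrow> s a x + s b y \<in> D)"

text \<open>
  A map that is only meaningful on a carrier is represented by its extension by zero (not by \<^const>\<open>undefined\<close>), so that such maps form a linear subspace of the function type.
\<close>

definition zero_ext :: "'v set \<Rightarrow> ('v \<Rightarrow> 'w::zero) \<Rightarrow> 'v \<Rightarrow> 'w" where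
  "zero_ext V f = (\<lambda>x. if x \<in> V then f x else 0)"

text \<open>
  The seminorm \<open>q\<close> may take arbitrary values off \<open>V\<close>, whereas the axioms of
  \<^locale>\<open>Metric_space\<close> constrain the distance of all points of the type; hence \<open>zero_ext\<close>.
\<close>

definition Banach_on ::
  "('k::real_normed_field \<Rightarrow> 'v::ab_group_add \<Rightarrow> 'v) \<Rightarrow> 'v set \<Rightarrow> ('v \<Rightarrow> real) \<Rightarrow> bool" where
  "Banach_on s V q \<longleftrightarrow> module.subspace s V \<and> seminorm_on s V q \<and> (\<forall>x\<in>V. q x = 0 \<longrightarrow> x = 0) \<and>
     Metric_space.mcomplete V (\<lambda>x y. zero_ext V q (x - y))"

definition gauge_span ::
  "('k::real_normed_field \<Rightarrow> 'v::ab_group_add \<Rightarrow> 'v) \<Rightarrow> 'v set \<Rightarrow> 'v set" where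
  "gauge_span s D = (\<Union>n::nat. s (of_nat n) ` D)"

definition Minkowski_gauge ::
  "('k::real_normed_field \<Rightarrow> 'v::ab_group_add \<Rightarrow> 'v) \<Rightarrow> 'v set \<Rightarrow> 'v \<Rightarrow> real" where
  "Minkowski_gauge s D x = Inf {t. 0 < t \<and> x \<in> s (of_real t) ` D}"

text \<open>The empty set is excluded because its span would not be a vector space.\<close>

definition locally_complete ::
  "('k::real_normed_field \<Rightarrow> 'e::ab_group_add \<Rightarrow> 'e) \<Rightarrow> ('e \<Rightarrow> real) set \<Rightarrow> bool" where
  "locally_complete s P \<longleftrightarrow>
     (\<forall>D. D \<noteq> {} \<and> closedin (seminorm_topology UNIV P) D \<and> bounded_wrt P D \<and>
        absolutely_convex s D \<longrightarrow> Banach_on s (gauge_span s D) (Minkowski_gauge s D))"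

section \<open>Duals and the epsilon product\<close>

definition continuous_linear_maps ::
  "('k::field \<Rightarrow> 'v::ab_group_add \<Rightarrow> 'v) \<Rightarrow> 'v topology \<Rightarrow>
   ('k \<Rightarrow> 'w::ab_group_add \<Rightarrow> 'w) \<Rightarrow> 'w topology \<Rightarrow> ('v \<Rightarrow> 'w) set" where
  "continuous_linear_maps s X t Y =
     {u. linear_map_on s t (topspace X) u \<and> continuous_map X Y u \<and> (\<forall>x. x \<notin> topspace X \<longrightarrow> u x = 0)}"

definition dual ::
  "('k::real_normed_field \<Rightarrow> 'v::ab_group_add \<Rightarrow> 'v) \<Rightarrow> 'v topology \<Rightarrow> ('v \<Rightarrow> 'k) set" where
  "dual s X = continuous_linear_maps s X (*) euclidean"

text \<open>
  The topology of \<open>X'\<^sub>\<kappa>\<close>. Index sets of suprema are required to be nonempty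
  here and below because \<^const>\<open>Sup\<close> of the empty set of reals is unspecified.
\<close>

definition kappa_dual ::
  "('k::real_normed_field \<Rightarrow> 'v::ab_group_add \<Rightarrow> 'v) \<Rightarrow> 'v topology \<Rightarrow> ('v \<Rightarrow> 'k) topology" where
  "kappa_dual s X = seminorm_topology (dual s X)
     {\<lambda>y. SUP x\<in>K. norm (y x) | K. K \<noteq> {} \<and> compactin X K \<and> absolutely_convex s K}"

definition equicontinuous ::
  "'v topology \<Rightarrow> ('v \<Rightarrow> 'k::real_normed_vector) set \<Rightarrow> bool" where
  "equicontinuous X H \<longleftrightarrow>
     (\<forall>x\<in>topspace X. \<forall>\<epsilon>>0. \<exists>W. openin X W \<and> x \<in> W \<and> (\<forall>y\<in>H. \<forall>z\<in>W. norm (y z - y x) < \<epsilon>))"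

definition eps_maps ::
  "('k::real_normed_field \<Rightarrow> 'v::ab_group_add \<Rightarrow> 'v) \<Rightarrow> 'v topology \<Rightarrow>
   ('k \<Rightarrow> 'e::ab_group_add \<Rightarrow> 'e) \<Rightarrow> ('e \<Rightarrow> real) set \<Rightarrow> (('v \<Rightarrow> 'k) \<Rightarrow> 'e) set" where
  "eps_maps s X t P =
     continuous_linear_maps (pointwise (*)) (kappa_dual s X) t (seminorm_topology UNIV P)"

definition eps_product ::
  "('k::real_normed_field \<Rightarrow> 'v::ab_group_add \<Rightarrow> 'v) \<Rightarrow> 'v topology \<Rightarrow>
   ('k \<Rightarrow> 'e::ab_group_add \<Rightarrow> 'e) \<Rightarrow> ('e \<Rightarrow> real) set \<Rightarrow> (('v \<Rightarrow> 'k) \<Rightarrow> 'e) topology" where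
  "eps_product s X t P = seminorm_topology (eps_maps s X t P)
     {\<lambda>u. SUP y\<in>H. q (u y) | q H. q \<in> P \<and> H \<noteq> {} \<and> H \<subseteq> dual s X \<and> equicontinuous X H}"

section \<open>Function spaces\<close>

text \<open>
  In the following, \<open>FK\<close> and \<open>FE\<close> are the topologies of \<open>F(\<Omega>)\<close> and \<open>F(\<Omega>, E)\<close>; the spaces
  themselves are their carriers. The sets \<open>\<Omega>\<close> and \<open>\<omega>\<close> are the types \<^typ>\<open>'o\<close> and \<^typ>\<open>'w\<close>.
\<close>

definition point_eval :: "('o \<Rightarrow> 'k::zero) topology \<Rightarrow> 'o \<Rightarrow> ('o \<Rightarrow> 'k) \<Rightarrow> 'k" where
  "point_eval FK x = zero_ext (topspace FK) (\<lambda>f. f x)"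

definition op_eval ::
  "('o \<Rightarrow> 'k::zero) topology \<Rightarrow> (('o \<Rightarrow> 'k) \<Rightarrow> 'w \<Rightarrow> 'k) \<Rightarrow> 'w \<Rightarrow> ('o \<Rightarrow> 'k) \<Rightarrow> 'k" where
  "op_eval FK TK x = zero_ext (topspace FK) (\<lambda>f. TK f x)"

definition S_map ::
  "('o \<Rightarrow> 'k::zero) topology \<Rightarrow> ((('o \<Rightarrow> 'k) \<Rightarrow> 'k) \<Rightarrow> 'e) \<Rightarrow> 'o \<Rightarrow> 'e" where
  "S_map FK u = (\<lambda>x. u (point_eval FK x))"

definition eps_into_compatible ::
  "('k::real_normed_field \<Rightarrow> 'e::ab_group_add \<Rightarrow> 'e) \<Rightarrow> ('e \<Rightarrow> real) set \<Rightarrow>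
   ('o \<Rightarrow> 'k) topology \<Rightarrow> ('o \<Rightarrow> 'e) topology \<Rightarrow> bool" where
  "eps_into_compatible s P FK FE \<longleftrightarrow>
     S_map FK ` eps_maps (pointwise (*)) FK s P \<subseteq> topspace FE \<and>
     linear_map_on (pointwise s) (pointwise s) (eps_maps (pointwise (*)) FK s P) (S_map FK) \<and>
     embedding_map (eps_product (pointwise (*)) FK s P) FE (S_map FK)"

text \<open>
  For \<open>Y \<in> {K, E}\<close> the weighted space is obtained from the set \<open>F = F(\<Omega>, Y)\<close>, the
  operator \<open>T = T\<^sup>Y\<close>, the system \<open>P\<close> of seminorms of \<open>Y\<close> (for \<open>Y = K\<close>: \<open>{norm}\<close>) and the weight.
\<close>

definition weighted_seminorm ::
  "(('o \<Rightarrow> 'y) \<Rightarrow> 'w \<Rightarrow> 'y) \<Rightarrow> ('w \<Rightarrow> real) \<Rightarrow> ('y \<Rightarrow> real) \<Rightarrow> ('o \<Rightarrow> 'y) \<Rightarrow> real" where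
  "weighted_seminorm T \<nu> q f = (SUP x. q (T f x) * \<nu> x)"

definition weighted_space ::
  "('o \<Rightarrow> 'y) set \<Rightarrow> (('o \<Rightarrow> 'y) \<Rightarrow> 'w \<Rightarrow> 'y) \<Rightarrow> ('w \<Rightarrow> real) \<Rightarrow> ('y \<Rightarrow> real) set \<Rightarrow> ('o \<Rightarrow> 'y) set" where
  "weighted_space F T \<nu> P = {f\<in>F. \<forall>q\<in>P. bdd_above (range (\<lambda>x. q (T f x) * \<nu> x))}"

definition weighted_topology ::
  "('o \<Rightarrow> 'y::ab_group_add) set \<Rightarrow> (('o \<Rightarrow> 'y) \<Rightarrow> 'w \<Rightarrow> 'y) \<Rightarrow> ('w \<Rightarrow> real) \<Rightarrow> ('y \<Rightarrow> real) set \<Rightarrow>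
   ('o \<Rightarrow> 'y) topology" where
  "weighted_topology F T \<nu> P =
     seminorm_topology (weighted_space F T \<nu> P) (weighted_seminorm T \<nu> ` P)"

definition weighted_lcs ::
  "('k::real_normed_field \<Rightarrow> 'y::ab_group_add \<Rightarrow> 'y) \<Rightarrow> ('o \<Rightarrow> 'y) set \<Rightarrow>
   (('o \<Rightarrow> 'y) \<Rightarrow> 'w \<Rightarrow> 'y) \<Rightarrow> ('w \<Rightarrow> real) \<Rightarrow> ('y \<Rightarrow> real) set \<Rightarrow> bool" where
  "weighted_lcs s F T \<nu> P \<longleftrightarrow>
     directed_seminorms (pointwise s) (weighted_space F T \<nu> P) (weighted_seminorm T \<nu> ` P) \<and>
     Hausdorff_space (weighted_topology F T \<nu> P)"

definition generator ::
  "('k::real_normed_field \<Rightarrow> 'e::ab_group_add \<Rightarrow> 'e) \<Rightarrow> ('e \<Rightarrow> real) set \<Rightarrow> ('w \<Rightarrow> real) \<Rightarrow>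
   ('o \<Rightarrow> 'k) topology \<Rightarrow> ('o \<Rightarrow> 'e) topology \<Rightarrow>
   (('o \<Rightarrow> 'e) \<Rightarrow> 'w \<Rightarrow> 'e) \<Rightarrow> (('o \<Rightarrow> 'k) \<Rightarrow> 'w \<Rightarrow> 'k) \<Rightarrow> bool" where
  "generator s P \<nu> FK FE TE TK \<longleftrightarrow>
     weighted_lcs (*) (topspace FK) TK \<nu> {norm} \<and> weighted_lcs s (topspace FE) TE \<nu> P \<and>
     (\<forall>x. point_eval (weighted_topology (topspace FK) TK \<nu> {norm}) x
            \<in> dual (pointwise (*)) (weighted_topology (topspace FK) TK \<nu> {norm}))"

definition consistent ::
  "('k::real_normed_field \<Rightarrow> 'e::ab_group_add \<Rightarrow> 'e) \<Rightarrow> ('e \<Rightarrow> real) set \<Rightarrow>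
   ('o \<Rightarrow> 'k) topology \<Rightarrow> ('o \<Rightarrow> 'e) topology \<Rightarrow>
   (('o \<Rightarrow> 'e) \<Rightarrow> 'w \<Rightarrow> 'e) \<Rightarrow> (('o \<Rightarrow> 'k) \<Rightarrow> 'w \<Rightarrow> 'k) \<Rightarrow> bool" where
  "consistent s P FK FE TE TK \<longleftrightarrow>
     (\<forall>u\<in>eps_maps (pointwise (*)) FK s P. \<forall>x.
        S_map FK u \<in> topspace FE \<and> op_eval FK TK x \<in> dual (pointwise (*)) FK \<and>
        TE (S_map FK u) x = u (op_eval FK TK x))"

definition strong ::
  "('k::real_normed_field \<Rightarrow> 'e::ab_group_add \<Rightarrow> 'e) \<Rightarrow> ('e \<Rightarrow> real) set \<Rightarrow>
   ('o \<Rightarrow> 'k) topology \<Rightarrow> ('o \<Rightarrow> 'e) topology \<Rightarrow>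
   (('o \<Rightarrow> 'e) \<Rightarrow> 'w \<Rightarrow> 'e) \<Rightarrow> (('o \<Rightarrow> 'k) \<Rightarrow> 'w \<Rightarrow> 'k) \<Rightarrow> bool" where
  "strong s P FK FE TE TK \<longleftrightarrow>
     (\<forall>e'\<in>dual s (seminorm_topology UNIV P). \<forall>f\<in>topspace FE. \<forall>x.
        e' \<circ> f \<in> topspace FK \<and> TK (e' \<circ> f) x = e' (TE f x))"

definition weighted_unit_ball ::
  "('o \<Rightarrow> 'k::real_normed_field) topology \<Rightarrow> (('o \<Rightarrow> 'k) \<Rightarrow> 'w \<Rightarrow> 'k) \<Rightarrow> ('w \<Rightarrow> real) \<Rightarrow>
   ('o \<Rightarrow> 'k) set" where
  "weighted_unit_ball FK TK \<nu> =
     {f \<in> weighted_space (topspace FK) TK \<nu> {norm}. weighted_seminorm TK \<nu> norm f \<le> 1}"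

definition dual_polar ::
  "('k::real_normed_field \<Rightarrow> 'v::ab_group_add \<Rightarrow> 'v) \<Rightarrow> 'v topology \<Rightarrow> 'v set \<Rightarrow> ('v \<Rightarrow> 'k) set" where
  "dual_polar s X B = {y \<in> dual s X. \<forall>f\<in>B. norm (y f) \<le> 1}"

definition weighted_eps_space ::
  "('k::real_normed_field \<Rightarrow> 'e::ab_group_add \<Rightarrow> 'e) \<Rightarrow> ('e \<Rightarrow> real) set \<Rightarrow> ('w \<Rightarrow> real) \<Rightarrow>
   ('o \<Rightarrow> 'k) topology \<Rightarrow> (('o \<Rightarrow> 'k) \<Rightarrow> 'w \<Rightarrow> 'k) \<Rightarrow> ('o \<Rightarrow> 'e) set" where
  "weighted_eps_space s P \<nu> FK TK =
     S_map FK ` {u \<in> eps_maps (pointwise (*)) FK s P.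
       bounded_wrt P (u ` dual_polar (pointwise (*)) FK (weighted_unit_ball FK TK \<nu>))}"

text \<open>Inserting 0 makes the supremum over an empty \<open>U\<close> equal to 0 and changes nothing otherwise.\<close>

definition fixes_topology ::
  "('o \<Rightarrow> 'k::real_normed_field) topology \<Rightarrow> (('o \<Rightarrow> 'k) \<Rightarrow> 'w \<Rightarrow> 'k) \<Rightarrow> ('w \<Rightarrow> real) \<Rightarrow>
   'w set \<Rightarrow> bool" where
  "fixes_topology FK TK \<nu> U \<longleftrightarrow>
     (\<exists>C>0. \<forall>f\<in>weighted_space (topspace FK) TK \<nu> {norm}.
        weighted_seminorm TK \<nu> norm f \<le> C * Sup (insert 0 ((\<lambda>x. norm (TK f x) * \<nu> x) ` U)))"

definition separating_subspace ::
  "('k::real_normed_field \<Rightarrow> 'e::ab_group_add \<Rightarrow> 'e) \<Rightarrow> ('e \<Rightarrow> real) set \<Rightarrow> ('e \<Rightarrow> 'k) set \<Rightarrow> bool" where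
  "separating_subspace s P G \<longleftrightarrow>
     G \<subseteq> dual s (seminorm_topology UNIV P) \<and> module.subspace (pointwise (*)) G \<and>
     (\<forall>x. (\<forall>e'\<in>G. e' x = 0) \<longrightarrow> x = 0)"

text \<open>Functions on \<open>U\<close> are elements of \<^term>\<open>extensional U\<close>.\<close>

definition weak_trace_space ::
  "('w \<Rightarrow> real) \<Rightarrow> ('o \<Rightarrow> 'k::real_normed_field) topology \<Rightarrow> (('o \<Rightarrow> 'k) \<Rightarrow> 'w \<Rightarrow> 'k) \<Rightarrow>
   ('e \<Rightarrow> 'k) set \<Rightarrow> 'w set \<Rightarrow> ('w \<Rightarrow> 'e) set" where
  "weak_trace_space \<nu> FK TK G U =
     {f \<in> extensional U. \<forall>e'\<in>G. \<exists>g\<in>weighted_space (topspace FK) TK \<nu> {norm}.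
        \<forall>x\<in>U. TK g x = (e' \<circ> f) x}"

definition weak_trace_space_lb ::
  "('k::real_normed_field \<Rightarrow> 'e \<Rightarrow> 'e) \<Rightarrow> ('e \<Rightarrow> real) set \<Rightarrow> ('w \<Rightarrow> real) \<Rightarrow>
   ('o \<Rightarrow> 'k) topology \<Rightarrow> (('o \<Rightarrow> 'k) \<Rightarrow> 'w \<Rightarrow> 'k) \<Rightarrow> ('e \<Rightarrow> 'k) set \<Rightarrow> 'w set \<Rightarrow> ('w \<Rightarrow> 'e) set" where
  "weak_trace_space_lb s P \<nu> FK TK G U =
     {f \<in> weak_trace_space \<nu> FK TK G U. bounded_wrt P ((\<lambda>x. s (of_real (\<nu> x)) (f x)) ` U)}"

definition restriction_map ::
  "(('o \<Rightarrow> 'e) \<Rightarrow> 'w \<Rightarrow> 'e) \<Rightarrow> 'w set \<Rightarrow> ('o \<Rightarrow> 'e) \<Rightarrow> 'w \<Rightarrow> 'e" where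
  "restriction_map TE U f = restrict (TE f) U"

end

theory Submission
  imports Defs
begin

text \<open>
  Let \<open>f\<close> be in the trace space, let \<open>g\<^sub>e'\<close> in \<open>F\<nu>(\<Omega>)\<close> represent \<open>e' \<circ> f\<close>, let \<open>B\<close> be the unit
  ball of \<open>F\<nu>(\<Omega>)\<close> and let \<open>D\<close> be the set cut out by the bounds of the seminorms on \<open>\<nu> f\<close>. A
  functional \<open>z \<in> F(\<Omega>)'\<close> is called representable if some \<open>d \<in> D\<close> satisfies \<open>e' d = z (g\<^sub>e')\<close> for all
  \<open>e' \<in> G\<close>; these functionals form an absolutely convex set containing \<open>\<nu>(x) T\<^sub>x\<close> for \<open>x \<in> U\<close>. As
  \<open>U\<close> fixes the topology, a minimax argument on the compact set \<open>B\<close> shows that every \<open>y \<in> B\<degree>\<close> is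
  approximated uniformly on \<open>B\<close> by \<open>C\<close> times representable functionals. Iterating writes \<open>y\<close> as
  \<open>C\<close> times the sum of \<open>2\<^sup>-\<^sup>k z\<^sub>k\<close> with \<open>z\<^sub>k\<close> representable, and the corresponding series in \<open>E\<close>
  converges in the Banach space \<open>E\<^sub>D\<close>. Its sum \<open>u y\<close> is the unique element with \<open>e' (u y) = y (g\<^sub>e')\<close>
  for all \<open>e' \<in> G\<close>, so \<open>u\<close> is linear; it is bounded on \<open>B\<degree>\<close> and hence continuous on \<open>F(\<Omega>)'\<^sub>\<kappa>\<close>.
\<close>

section \<open>Minimax on compact convex sets\<close>

text \<open>The pair \<open>(g, h)\<close> maps \<open>B\<close> onto a compact convex set in the
  plane that misses the closed positive quadrant. A strictly separating line has a normal with
  nonnegative entries, because the quadrant is a cone; normalising their sum to 1 gives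
  \<open>t\<close>. Hypothesis \<open>conv\<close> expresses affinity through values only, so no
  linear structure on the points is involved.\<close>

lemma convex_pair_separation:
  fixes g h :: "'a \<Rightarrow> real"
  assumes B: "compactin X B"
    and g: "continuous_map X euclideanreal g" and h: "continuous_map X euclideanreal h"
    and conv: "\<And>b c t. \<lbrakk>b \<in> B; c \<in> B; 0 \<le> t; t \<le> 1\<rbrakk> \<Longrightarrow>
                 \<exists>d\<in>B. g d = (1 - t) * g b + t * g c \<and> h d = (1 - t) * h b + t * h c"
    and neg: "\<And>b. b \<in> B \<Longrightarrow> g b < 0 \<or> h b < 0"
  shows "\<exists>t. 0 \<le> t \<and> t \<le> 1 \<and> (\<forall>b\<in>B. (1 - t) * g b + t * h b < 0)"
proof (cases "B = {}")
  case False
  define S where "S = (\<lambda>b. (g b, h b)) ` B"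
  define Q where "Q = {p :: real \<times> real. 0 \<le> fst p \<and> 0 \<le> snd p}"
  have "continuous_map X (euclidean :: (real \<times> real) topology) (\<lambda>b. (g b, h b))"
    using continuous_map_pairedI[OF g h] by (simp add: euclidean_product_topology)
  from image_compactin[OF B this] have S: "compact S"
    by (simp add: S_def compactin_euclidean_iff)
  have "convex S"
    unfolding convex_alt
  proof (intro ballI allI impI)
    fix p q :: "real \<times> real" and t :: real assume "p \<in> S" "q \<in> S" and t: "0 \<le> t \<and> t \<le> 1"
    then obtain b c where bc: "b \<in> B" "c \<in> B" "p = (g b, h b)" "q = (g c, h c)"
      by (auto simp: S_def)
    obtain d where "d \<in> B" "g d = (1 - t) * g b + t * g c" "h d = (1 - t) * h b + t * h c"
      using conv[OF bc(1,2)] t by blast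
    then show "(1 - t) *\<^sub>R p + t *\<^sub>R q \<in> S"
      unfolding S_def using bc by (intro image_eqI[of _ _ d]) auto
  qed
  moreover have "convex Q"
    unfolding Q_def convex_def by auto
  moreover have "closed Q"
    unfolding Q_def by (intro closed_Collect_conj closed_Collect_le continuous_intros)
  moreover have "S \<inter> Q = {}" "S \<noteq> {}"
    using neg False unfolding S_def Q_def by force+
  ultimately obtain a \<beta> where a: "\<And>p. p \<in> S \<Longrightarrow> inner a p < \<beta>" "\<And>p. p \<in> Q \<Longrightarrow> \<beta> < inner a p"
    using separating_hyperplane_compact_closed[of S Q] S by blast
  obtain a1 a2 where a12: "a = (a1, a2)" by (cases a)
  have S': "a1 * g b + a2 * h b < \<beta>" if "b \<in> B" for b
    using a(1)[of "(g b, h b)"] that by (auto simp: S_def a12)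
  have Q': "\<beta> < a1 * x + a2 * y" if "0 \<le> x" "0 \<le> y" for x y
    using a(2)[of "(x, y)"] that by (auto simp: Q_def a12)
  have \<beta>: "\<beta> < 0" using Q'[of 0 0] by simp
  \<comment> \<open>A negative entry would put \<open>(\<beta> / a1, 0)\<close> into
    \<open>Q\<close>, where the separating functional takes exactly the value
    \<open>\<beta>\<close>, against the strict inequality \<open>Q'\<close>.\<close>
  have a1: "0 \<le> a1"
  proof (rule ccontr)
    assume "\<not> 0 \<le> a1" then show False using Q'[of "\<beta> / a1" 0] \<beta> by (simp add: field_simps)
  qed
  have a2: "0 \<le> a2"
  proof (rule ccontr)
    assume "\<not> 0 \<le> a2" then show False using Q'[of 0 "\<beta> / a2"] \<beta> by (simp add: field_simps)
  qed
  obtain b0 where "b0 \<in> B" using False by blast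
  then have "a1 \<noteq> 0 \<or> a2 \<noteq> 0" using S'[of b0] \<beta> by auto
  then have pos: "0 < a1 + a2" using a1 a2 by linarith
  define t where "t = a2 / (a1 + a2)"
  have "(1 - t) * g b + t * h b < 0" if "b \<in> B" for b
  proof -
    have "1 - t = a1 / (a1 + a2)" using pos by (simp add: t_def field_simps)
    then have "(1 - t) * g b + t * h b = (a1 * g b + a2 * h b) / (a1 + a2)"
      by (simp add: t_def add_divide_distrib)
    also have "\<dots> < 0" using S'[OF that] \<beta> pos by (intro divide_neg_pos) auto
    finally show ?thesis .
  qed
  moreover have "0 \<le> t" "t \<le> 1" using a1 a2 pos by (auto simp: t_def)
  ultimately show ?thesis by blast
qed (auto intro: exI[of _ 0])

text \<open>The sets where some \<open>g\<close> is negative form an open cover of \<open>B\<close>,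
  so finitely many functions already satisfy \<open>neg\<close>. Such a family is merged into one
  function by repeated use of \<open>convex_pair_separation\<close>. In \<open>aff\<close> a single
  point \<open>d\<close> serves all functions at once; this expresses that \<open>B\<close> is
  convex and all functions are affine on it.\<close>

lemma compact_minimax:
  fixes \<Phi> :: "('a \<Rightarrow> real) set"
  assumes B: "compactin X B" and ne: "\<Phi> \<noteq> {}"
    and cont: "\<And>g. g \<in> \<Phi> \<Longrightarrow> continuous_map X euclideanreal g"
    and cvx: "\<And>g h t. \<lbrakk>g \<in> \<Phi>; h \<in> \<Phi>; 0 \<le> t; t \<le> 1\<rbrakk> \<Longrightarrow> (\<lambda>b. (1 - t) * g b + t * h b) \<in> \<Phi>"
    and aff: "\<And>b c t. \<lbrakk>b \<in> B; c \<in> B; 0 \<le> t; t \<le> 1\<rbrakk> \<Longrightarrow>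
                \<exists>d\<in>B. \<forall>g\<in>\<Phi>. g d = (1 - t) * g b + t * g c"
    and neg: "\<And>b. b \<in> B \<Longrightarrow> \<exists>g\<in>\<Phi>. g b < 0"
  shows "\<exists>g\<in>\<Phi>. \<forall>b\<in>B. g b < 0"
proof -
  \<comment> \<open>The compact set is a variable of the claim because the induction step passes to
    a smaller one. The functions covering it come from \<open>\<Gamma>\<close>, but the resulting
    \<open>g\<close> may be any member of \<open>\<Phi>\<close>, since convex combinations leave
    \<open>\<Gamma>\<close>.\<close>
  have fin: "\<exists>g\<in>\<Phi>. \<forall>b\<in>B'. g b < 0"
    if "finite \<Gamma>" "\<Gamma> \<subseteq> \<Phi>" "compactin X B'"
      "\<And>b c t. \<lbrakk>b \<in> B'; c \<in> B'; 0 \<le> t; t \<le> 1\<rbrakk> \<Longrightarrow> \<exists>d\<in>B'. \<forall>g\<in>\<Phi>. g d = (1 - t) * g b + t * g c"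
      "\<And>b. b \<in> B' \<Longrightarrow> \<exists>g\<in>\<Gamma>. g b < 0" for \<Gamma> B'
    using that
  proof (induction \<Gamma> arbitrary: B' rule: finite_induct)
    case empty
    then show ?case using ne by blast
  next
    case (insert h \<Gamma>)
    \<comment> \<open>The induction hypothesis deals with the part of \<open>B'\<close> where the
      new function is nonnegative, and two functions can be separated in the plane.\<close>
    define A where "A = {b \<in> B'. 0 \<le> h b}"
    have h: "h \<in> \<Phi>" using insert.prems by blast
    have "A = {x \<in> topspace X. h x \<in> {0..}} \<inter> B'"
      using compactin_subset_topspace[OF insert.prems(2)] by (auto simp: A_def)
    moreover have "closedin X {x \<in> topspace X. h x \<in> {0..}}"
      using cont[OF h] by (intro closedin_continuous_map_preimage) auto
    ultimately have A: "compactin X A"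
      using closed_Int_compactin insert.prems(2) by metis
    have "\<exists>g\<in>\<Phi>. \<forall>b\<in>A. g b < 0"
    proof (rule insert.IH)
      show "\<Gamma> \<subseteq> \<Phi>" "compactin X A" using insert.prems A by auto
      show "\<exists>g\<in>\<Gamma>. g b < 0" if "b \<in> A" for b
        using insert.prems(4)[of b] that by (auto simp: A_def)
      \<comment> \<open>\<open>A\<close> inherits the convexity of \<open>B'\<close>: the function
        \<open>h\<close> belongs to \<open>\<Phi>\<close>, so \<open>h d\<close> is a convex
        combination of nonnegative values.\<close>
      show "\<exists>d\<in>A. \<forall>g\<in>\<Phi>. g d = (1 - t) * g b + t * g c"
        if bct: "b \<in> A" "c \<in> A" "0 \<le> t" "t \<le> 1" for b c t
      proof -
        obtain d where "d \<in> B'" "\<forall>g\<in>\<Phi>. g d = (1 - t) * g b + t * g c"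
          using insert.prems(3)[of b c t] bct by (auto simp: A_def)
        then show ?thesis using bct h by (intro bexI[of _ d]) (auto simp: A_def)
      qed
    qed
    then obtain g where g: "g \<in> \<Phi>" "\<And>b. b \<in> A \<Longrightarrow> g b < 0" by blast
    have "\<exists>t. 0 \<le> t \<and> t \<le> 1 \<and> (\<forall>b\<in>B'. (1 - t) * g b + t * h b < 0)"
    proof (rule convex_pair_separation[OF insert.prems(2) cont[OF g(1)] cont[OF h]])
      show "g b < 0 \<or> h b < 0" if "b \<in> B'" for b
        using g(2)[of b] that by (auto simp: A_def)
      show "\<exists>d\<in>B'. g d = (1 - t) * g b + t * g c \<and> h d = (1 - t) * h b + t * h c"
        if "b \<in> B'" "c \<in> B'" "0 \<le> t" "t \<le> 1" for b c t
        using insert.prems(3)[OF that] g(1) h by blast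
    qed
    then show ?case using cvx[OF g(1) h] by (metis (no_types, lifting))
  qed
  have "\<exists>\<F>. finite \<F> \<and> \<F> \<subseteq> (\<lambda>g. {x \<in> topspace X. g x \<in> {..<0}}) ` \<Phi> \<and> B \<subseteq> \<Union>\<F>"
  proof (rule compactinD[OF B])
    show "openin X W" if "W \<in> (\<lambda>g. {x \<in> topspace X. g x \<in> {..<0}}) ` \<Phi>" for W
      using that cont by (auto intro!: openin_continuous_map_preimage simp del: lessThan_iff)
    show "B \<subseteq> \<Union> ((\<lambda>g. {x \<in> topspace X. g x \<in> {..<0}}) ` \<Phi>)"
      using neg compactin_subset_topspace[OF B] by auto
  qed
  then obtain \<Gamma> where \<Gamma>: "finite \<Gamma>" "\<Gamma> \<subseteq> \<Phi>" "B \<subseteq> \<Union> ((\<lambda>g. {x \<in> topspace X. g x \<in> {..<0}}) ` \<Gamma>)"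
    by (metis (no_types, lifting) finite_subset_image)
  show ?thesis
    by (rule fin[OF \<Gamma>(1,2) B aff]) (use \<Gamma>(3) in auto)
qed

section \<open>Locally convex spaces and their duals\<close>

lemma vector_space_pointwise:
  assumes "vector_space s"
  shows "vector_space (pointwise s)"
proof -
  interpret vector_space s by fact
  show ?thesis
    by unfold_locales
      (auto simp: pointwise_def fun_eq_iff scale_right_distrib scale_left_distrib)
qed

lemma vector_space_field_mult: "vector_space ((*) :: 'k::field \<Rightarrow> 'k \<Rightarrow> 'k)"
  by unfold_locales (auto simp: algebra_simps)

lemmas vector_space_pointwise_field = vector_space_pointwise[OF vector_space_field_mult]

lemma module_vector_space: "vector_space s \<Longrightarrow> module s"
  by (simp add: vector_space_def module_def)

lemma seminorm_on_0:
  assumes "vector_space s" "module.subspace s V" "seminorm_on s V q"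
  shows "q 0 = 0"
proof -
  interpret vector_space s by fact
  have "0 \<in> V" using assms(2) subspace_0 by blast
  then have "q (s 0 0) = norm (0::'a) * q 0"
    using assms(3) unfolding seminorm_on_def by blast
  then show ?thesis by simp
qed

lemma seminorm_on_minus:
  assumes "vector_space s" "module.subspace s V" "seminorm_on s V q" "x \<in> V"
  shows "q (- x) = q x"
proof -
  interpret vector_space s by fact
  have "q (s (- 1) x) = norm (- 1::'a) * q x"
    using assms(3,4) unfolding seminorm_on_def by blast
  then show ?thesis by simp
qed

lemma topspace_seminorm_topology:
  assumes "vector_space s" "module.subspace s V" "P \<noteq> {}"
    and "\<And>q. q \<in> P \<Longrightarrow> seminorm_on s V q"
  shows "topspace (seminorm_topology V P) = V"
proof -
  interpret vector_space s by fact
  obtain q where q: "q \<in> P" using assms(3) by blast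
  have "q 0 = 0" using seminorm_on_0 assms q by blast
  then have "x \<in> \<Union> {{y \<in> V. q (y - x) < r} | q x r. q \<in> P \<and> x \<in> V \<and> 0 < r}" if "x \<in> V" for x
    using that q by (intro UnionI[of "{y \<in> V. q (y - x) < 1}"] CollectI exI[of _ q] exI[of _ x] exI[of _ "1::real"]) auto
  then show ?thesis
    unfolding seminorm_topology_def by auto
qed

lemma openin_seminorm_ball:
  assumes "q \<in> P" "x \<in> V" "0 < r"
  shows "openin (seminorm_topology V P) {y \<in> V. q (y - x) < r}"
  unfolding seminorm_topology_def using assms by (intro topology_generated_by_Basis) blast

text \<open>By definition the seminorm balls form only a subbase. Directedness dominates two
  seminorms by one, which handles finite intersections, and the triangle inequality recentres a ball
  at \<open>x\<close>. So balls around \<open>x\<close> in a single seminorm form a neighbourhood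
  base.\<close>

lemma seminorm_topology_nhd:
  assumes vs: "vector_space s" and V: "module.subspace s V" and P: "directed_seminorms s V P"
    and W: "openin (seminorm_topology V P) W" "x \<in> W"
  shows "\<exists>q\<in>P. \<exists>r>0. {y \<in> V. q (y - x) < r} \<subseteq> W"
proof -
  interpret vector_space s by fact
  have sn: "\<And>q. q \<in> P \<Longrightarrow> seminorm_on s V q" using P by (auto simp: directed_seminorms_def)
  have x: "x \<in> V"
    using openin_subset[OF W(1)] W(2) by (auto simp: seminorm_topology_def)
  have "generate_topology_on {{y \<in> V. q (y - x) < r} | q x r. q \<in> P \<and> x \<in> V \<and> 0 < r} W"
    using W(1) unfolding seminorm_topology_def by (rule openin_topology_generated_by)
  then show ?thesis using \<open>x \<in> W\<close>
  proof (induction rule: generate_topology_on.induct)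
    case Empty then show ?case by simp
  next
    case (Int A B)
    from Int obtain q1 r1 where 1: "q1 \<in> P" "r1 > 0" "{y \<in> V. q1 (y - x) < r1} \<subseteq> A" by blast
    from Int obtain q2 r2 where 2: "q2 \<in> P" "r2 > 0" "{y \<in> V. q2 (y - x) < r2} \<subseteq> B" by blast
    obtain q C where q: "q \<in> P" "C > 0" "\<And>x. x \<in> V \<Longrightarrow> max (q1 x) (q2 x) \<le> C * q x"
      using P 1(1) 2(1) unfolding directed_seminorms_def by (elim conjE) (drule (1) bspec, drule (1) bspec, blast)
    have "y \<in> A \<inter> B" if y: "y \<in> V" "q (y - x) < min r1 r2 / C" for y
    proof -
      have "max (q1 (y - x)) (q2 (y - x)) \<le> C * q (y - x)"
        using q(3) subspace_diff[OF V y(1) x] by blast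
      also have "\<dots> < min r1 r2" using y(2) q(2) by (simp add: field_simps)
      finally show ?thesis using 1 2 y(1) by auto
    qed
    then show ?case using q 1 2 by (intro bexI[of _ q] exI[of _ "min r1 r2 / C"]) auto
  next
    case (UN K)
    then obtain k where "k \<in> K" "x \<in> k" by blast
    with UN.IH[of k] show ?case by (meson Union_upper subset_trans)
  next
    case (Basis A)
    then obtain q z r where A: "A = {y \<in> V. q (y - z) < r}" "q \<in> P" "z \<in> V" "0 < r" by blast
    have x: "x \<in> V" "q (x - z) < r" using Basis A by auto
    have "y \<in> A" if y: "y \<in> V" "q (y - x) < r - q (x - z)" for y
    proof -
      have "q ((y - x) + (x - z)) \<le> q (y - x) + q (x - z)"
        using sn[OF A(2)] x(1) y(1) A(3) V subspace_diff unfolding seminorm_on_def by blast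
      then show ?thesis using y A(1) by simp
    qed
    then show ?case using A(2) x by (intro bexI[of _ q] exI[of _ "r - q (x - z)"]) auto
  qed
qed

section \<open>Continuous linear functionals\<close>

lemma dual_add: "y \<in> dual s X \<Longrightarrow> a \<in> topspace X \<Longrightarrow> b \<in> topspace X \<Longrightarrow> y (a + b) = y a + y b"
  and dual_scale: "y \<in> dual s X \<Longrightarrow> a \<in> topspace X \<Longrightarrow> y (s c a) = c * y a"
  and dual_continuous: "y \<in> dual s X \<Longrightarrow> continuous_map X euclidean y"
  and dual_subspace_topspace: "y \<in> dual s X \<Longrightarrow> module.subspace s (topspace X)"
  by (auto simp: dual_def continuous_linear_maps_def linear_map_on_def)

lemma dual_0:
  assumes "vector_space s" "y \<in> dual s X"
  shows "y 0 = 0"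
proof -
  interpret vector_space s by fact
  have "0 \<in> topspace X" using dual_subspace_topspace[OF assms(2)] subspace_0 by blast
  then show ?thesis using dual_scale[OF assms(2), of 0 0] by simp
qed

lemma dual_diff:
  assumes "vector_space s" "y \<in> dual s X" "a \<in> topspace X" "b \<in> topspace X"
  shows "y (a - b) = y a - y b"
proof -
  interpret vector_space s by fact
  have "a - b \<in> topspace X"
    using subspace_diff[OF dual_subspace_topspace[OF assms(2)]] assms by blast
  from dual_add[OF assms(2) this assms(4)] show ?thesis by (simp add: algebra_simps)
qed

lemma subspace_dual:
  assumes vs: "vector_space s" and X: "module.subspace s (topspace X)"
  shows "module.subspace (pointwise (*)) (dual s X)"
proof -
  interpret F: vector_space "pointwise (*) :: 'a \<Rightarrow> ('b \<Rightarrow> 'a) \<Rightarrow> _"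
    by (rule vector_space_pointwise_field)
  have mult: "continuous_map X euclidean (\<lambda>x. c * f x)"
    if "continuous_map X euclidean f" for c :: 'a and f
    using continuous_map_compose[OF that, of euclidean "\<lambda>x. c * x"]
    by (simp add: o_def continuous_on_mult_left)
  show ?thesis
    by (rule F.subspaceI)
      (use X in \<open>auto simp: dual_def continuous_linear_maps_def linear_map_on_def pointwise_def
         algebra_simps func_plus func_zero intro!: continuous_map_add mult\<close>)
qed

text \<open>Continuity at 0 gives a ball of one seminorm on which the functional stays below 1, and
  homogeneity extends this to a global estimate.\<close>

lemma dual_bound:
  assumes vs: "vector_space s" and P: "directed_seminorms s UNIV P"
    and y: "y \<in> dual s (seminorm_topology UNIV P)"
  shows "\<exists>q\<in>P. \<exists>C>0. \<forall>x. norm (y x) \<le> C * q x"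
proof -
  interpret vector_space s by fact
  have sn: "\<And>q. q \<in> P \<Longrightarrow> seminorm_on s UNIV q" and "P \<noteq> {}"
    using P by (auto simp: directed_seminorms_def)
  then have top: "topspace (seminorm_topology UNIV P) = UNIV"
    using topspace_seminorm_topology[OF vs] by simp
  have y0: "y 0 = 0" using dual_0[OF vs y] .
  have "openin (seminorm_topology UNIV P) {x \<in> topspace (seminorm_topology UNIV P). y x \<in> ball 0 1}"
    by (rule openin_continuous_map_preimage[OF dual_continuous[OF y]]) simp
  from seminorm_topology_nhd[OF vs subspace_UNIV P this, of 0]
  obtain q r where q: "q \<in> P" "r > 0" "\<And>x. q x < r \<Longrightarrow> norm (y x) < 1"
    by (auto simp: top y0)
  have sc: "y (s c x) = c * y x" "q (s c x) = norm c * q x" "0 \<le> q x" for c x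
    using dual_scale[OF y] sn[OF q(1)] by (auto simp: top seminorm_on_def)
  have "norm (y x) \<le> 2 / r * q x" for x
  proof (rule field_le_epsilon)
    fix e :: real assume e: "e > 0"
    \<comment> \<open>The summand \<open>e\<close> keeps the scaling factor positive even if
      \<open>q x = 0\<close>.\<close>
    define t where "t = (2 / r * q x + e)"
    have t: "t > 0" using sc(3)[of x] q(2) e by (simp add: t_def add_nonneg_pos)
    have "q (s (of_real (1 / t)) x) = q x / t" using t by (simp add: sc norm_divide)
    also have "\<dots> < r"
    proof -
      have "r * t = 2 * q x + r * e" using q(2) by (simp add: t_def algebra_simps)
      moreover have "r * e > 0" using q(2) e by simp
      ultimately have "q x < r * t" using sc(3)[of x] by linarith
      then show ?thesis using t by (simp add: field_simps)
    qed
    finally have "norm (y (s (of_real (1 / t)) x)) < 1" by (rule q(3))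
    then have "norm (y x) / t < 1" using t by (simp add: sc norm_mult norm_divide)
    then show "norm (y x) \<le> 2 / r * q x + e" using t by (simp add: t_def field_simps)
  qed
  moreover have "2 / r > 0" using q(2) by simp
  ultimately show ?thesis using q(1) by blast
qed

section \<open>Uniform approximation of functionals on compact absolutely convex sets\<close>

text \<open>Obtained by pulling back the complex real part along the isometric embedding of the
  field. It turns scalar functionals into the real functions that the minimax argument
  requires.\<close>

lemma ex_real_part:
  "\<exists>re :: 'k::real_or_complex \<Rightarrow> real. bounded_linear re \<and> (\<forall>x. \<bar>re x\<bar> \<le> norm x) \<and> (\<forall>r. re (of_real r) = r)"
proof -
  obtain \<phi> :: "'k \<Rightarrow> complex" where \<phi>: "\<And>x y. \<phi> (x + y) = \<phi> x + \<phi> y" "\<phi> 1 = 1"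
    "\<And>r x. \<phi> (r *\<^sub>R x) = r *\<^sub>R \<phi> x" "\<And>x. norm (\<phi> x) = norm x"
    using ex_iso_real_or_complex[where ?'a = 'k] by blast
  have le: "\<bar>Re (\<phi> x)\<bar> \<le> norm x" for x using abs_Re_le_cmod[of "\<phi> x"] \<phi>(4) by simp
  have "bounded_linear (\<lambda>x. Re (\<phi> x))"
    by (rule bounded_linear_intro[of _ 1]) (use le in \<open>auto simp: \<phi>\<close>)
  moreover have "Re (\<phi> (of_real r)) = r" for r
    by (simp add: of_real_def \<phi>)
  ultimately show ?thesis using le by blast
qed

text \<open>The rotation that makes a scalar real and nonnegative. On balanced sets it converts
  bounds on real parts into bounds on norms.\<close>

lemma ex_unimodular:
  fixes w :: "'k::real_normed_field"
  shows "\<exists>c. norm c = 1 \<and> c * w = of_real (norm w)"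
proof (cases "w = 0")
  case False
  then show ?thesis by (intro exI[of _ "of_real (norm w) / w"]) (simp add: norm_divide)
qed (auto intro: exI[of _ 1])

lemma absolutely_convex_scale:
  assumes "vector_space s" "absolutely_convex s D" "x \<in> D" "norm c \<le> 1"
  shows "s c x \<in> D"
proof -
  interpret vector_space s by fact
  have "norm c + norm (0::'a) \<le> 1" using assms by simp
  then have "s c x + s 0 x \<in> D" using assms unfolding absolutely_convex_def by blast
  then show ?thesis by simp
qed

text \<open>Hypothesis \<open>le\<close> only compares absolute values, and its \<open>z\<close>
  depends on the point \<open>b\<close>. Applying \<open>compact_minimax\<close> to the functions
  \<open>re (y b - z b) - \<epsilon>\<close> exchanges the quantifiers and yields one
  \<open>z\<close> that is good on all of \<open>B\<close>.\<close>

lemma dual_approximation: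
  fixes s :: "'k::real_or_complex \<Rightarrow> 'v::ab_group_add \<Rightarrow> 'v"
  assumes vs: "vector_space s" and B: "compactin X B" "absolutely_convex s B"
    and \<Phi>: "\<Phi> \<subseteq> dual s X" "\<Phi> \<noteq> {}" "absolutely_convex (pointwise (*)) \<Phi>"
    and y: "y \<in> dual s X"
    and le: "\<And>b \<epsilon>. b \<in> B \<Longrightarrow> 0 < \<epsilon> \<Longrightarrow> \<exists>z\<in>\<Phi>. norm (y b) \<le> norm (z b) + \<epsilon>"
    and \<epsilon>: "0 < \<epsilon>"
  shows "\<exists>z\<in>\<Phi>. \<forall>b\<in>B. norm (y b - z b) < \<epsilon>"
proof -
  interpret vector_space s by fact
  note vF = vector_space_pointwise_field[where ?'a = 'k and ?'c = 'v]
  obtain re :: "'k \<Rightarrow> real" where re: "bounded_linear re" "\<And>x. \<bar>re x\<bar> \<le> norm x" "\<And>r. re (of_real r) = r"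
    using ex_real_part by blast
  interpret re: bounded_linear re by fact
  have top: "b \<in> topspace X" if "b \<in> B" for b using B(1) that compactin_subset_topspace by blast
  have sub: "module.subspace s (topspace X)" using dual_subspace_topspace[OF y] .
  define \<Psi> where "\<Psi> = (\<lambda>z b. re (y b - z b) - \<epsilon>) ` \<Phi>"
  have re_of_real: "re (of_real t * x) = t * re x" for t x
    using re.scaleR[of t x] by (simp add: scaleR_conv_of_real)
  have norm_convex: "norm (of_real (1 - t) :: 'k) + norm (of_real t :: 'k) \<le> 1" if "0 \<le> t" "t \<le> 1" for t
    unfolding norm_of_real using that by simp
  \<comment> \<open>Real parts suffice because \<open>B\<close> and \<open>\<Phi>\<close> are balanced.\<close>
  have "\<exists>g\<in>\<Psi>. \<forall>b\<in>B. g b < 0"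
  proof (rule compact_minimax[OF B(1)])
    show "\<Psi> \<noteq> {}" using \<Phi> by (simp add: \<Psi>_def)
    show "continuous_map X euclideanreal g" if g: "g \<in> \<Psi>" for g
    proof -
      obtain z where z: "z \<in> \<Phi>" "g = (\<lambda>b. re (y b - z b) - \<epsilon>)" using g by (auto simp: \<Psi>_def)
      have "continuous_map X euclidean (\<lambda>b. y b - z b)"
        using z \<Phi>(1) y by (intro continuous_map_diff dual_continuous[of _ s]) auto
      from continuous_map_compose[OF this, of euclidean "\<lambda>w. re w - \<epsilon>"]
      show ?thesis
        by (simp add: z(2) o_def continuous_intros re.continuous_on)
    qed
    show "(\<lambda>b. (1 - t) * g b + t * h b) \<in> \<Psi>"
      if gh: "g \<in> \<Psi>" "h \<in> \<Psi>" and t: "0 \<le> t" "t \<le> 1" for g h t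
    proof -
      obtain z1 z2 where z: "z1 \<in> \<Phi>" "g = (\<lambda>b. re (y b - z1 b) - \<epsilon>)"
          "z2 \<in> \<Phi>" "h = (\<lambda>b. re (y b - z2 b) - \<epsilon>)"
        using gh by (auto simp: \<Psi>_def)
      define w where "w = pointwise (*) (of_real (1 - t)) z1 + pointwise (*) (of_real t) z2"
      have "w \<in> \<Phi>"
        using \<Phi>(3) z norm_convex[OF t] unfolding absolutely_convex_def w_def by blast
      moreover have "(\<lambda>b. (1 - t) * g b + t * h b) = (\<lambda>b. re (y b - w b) - \<epsilon>)"
      proof
        fix b
        have "re (w b) = (1 - t) * re (z1 b) + t * re (z2 b)"
          unfolding w_def pointwise_def plus_fun_apply re.add re_of_real ..
        then show "(1 - t) * g b + t * h b = re (y b - w b) - \<epsilon>"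
          by (simp add: z re.diff) (simp add: algebra_simps)
      qed
      ultimately show ?thesis by (simp add: \<Psi>_def)
    qed
    show "\<exists>d\<in>B. \<forall>g\<in>\<Psi>. g d = (1 - t) * g b + t * g c"
      if bc: "b \<in> B" "c \<in> B" and t: "0 \<le> t" "t \<le> 1" for b c t
    proof (intro bexI ballI)
      let ?d = "s (of_real (1 - t)) b + s (of_real t) c"
      show "?d \<in> B"
        using B(2) bc norm_convex[OF t] unfolding absolutely_convex_def by blast
      have lin: "re (z ?d) = (1 - t) * re (z b) + t * re (z c)" if z: "z \<in> dual s X" for z
        using top[OF bc(1)] top[OF bc(2)] subspace_scale[OF sub]
        by (simp only: dual_add[OF z] dual_scale[OF z] re.add re_of_real)
      fix g assume "g \<in> \<Psi>"
      then obtain z where z: "z \<in> \<Phi>" "g = (\<lambda>b. re (y b - z b) - \<epsilon>)" by (auto simp: \<Psi>_def)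
      have "z \<in> dual s X" using z(1) \<Phi>(1) by blast
      note lz = lin[OF this] lin[OF y]
      show "g ?d = (1 - t) * g b + t * g c"
        by (simp only: z re.diff lz) (simp add: algebra_simps)
    qed
    show "\<exists>g\<in>\<Psi>. g b < 0" if b: "b \<in> B" for b
    proof -
      \<comment> \<open>Half of \<open>\<epsilon>\<close> is kept back to make the final inequality
        strict. After rotating \<open>z\<close> so that its value at \<open>b\<close> becomes
        \<open>norm (z b)\<close>, the real part of the difference is at most
        \<open>norm (y b) - norm (z b)\<close>.\<close>
      obtain z where z: "z \<in> \<Phi>" "norm (y b) \<le> norm (z b) + \<epsilon> / 2"
        using le[OF b, of "\<epsilon> / 2"] \<epsilon> by auto
      obtain c where c: "norm c = 1" "c * z b = of_real (norm (z b))" using ex_unimodular by blast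
      have "pointwise (*) c z \<in> \<Phi>"
        using absolutely_convex_scale[OF vF \<Phi>(3) z(1)] c by simp
      then have "(\<lambda>b. re (y b - c * z b) - \<epsilon>) \<in> \<Psi>"
        unfolding \<Psi>_def pointwise_def by (rule rev_image_eqI) simp
      moreover have "re (y b - c * z b) - \<epsilon> < 0"
        using z(2) re(2)[of "y b"] \<epsilon> by (simp add: re.diff c re(3))
      ultimately show ?thesis by (intro bexI[of _ "\<lambda>b. re (y b - c * z b) - \<epsilon>"])
    qed
  qed
  then obtain z where z: "z \<in> \<Phi>" "\<And>b. b \<in> B \<Longrightarrow> re (y b - z b) < \<epsilon>" by (auto simp: \<Psi>_def)
  have "norm (y b - z b) < \<epsilon>" if b: "b \<in> B" for b
  proof -
    obtain c where c: "norm c = 1" "c * (y b - z b) = of_real (norm (y b - z b))"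
      using ex_unimodular by blast
    have zd: "z \<in> dual s X" using z(1) \<Phi>(1) by blast
    have "s c b \<in> B" using absolutely_convex_scale[OF vs B(2) b] c by simp
    from z(2)[OF this] have "re (c * (y b - z b)) < \<epsilon>"
      using top[OF b] by (simp add: dual_scale[OF y] dual_scale[OF zd] algebra_simps)
    then show ?thesis by (simp add: c re(3))
  qed
  then show ?thesis using z(1) by blast
qed

section \<open>Series in locally complete spaces\<close>

lemma Banach_on_Metric_space:
  assumes vs: "vector_space s" and V: "Banach_on s V q"
  shows "Metric_space V (\<lambda>x y. zero_ext V q (x - y))"
proof -
  interpret vector_space s by fact
  have sub: "subspace V" and sn: "seminorm_on s V q" and ne: "\<And>x. x \<in> V \<Longrightarrow> q x = 0 \<Longrightarrow> x = 0"
    using V by (auto simp: Banach_on_def)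
  show ?thesis
  proof
    show "0 \<le> zero_ext V q (x - y)" for x y
      using sn by (auto simp: zero_ext_def seminorm_on_def)
    show "zero_ext V q (x - y) = zero_ext V q (y - x)" for x y
      using seminorm_on_minus[OF vs sub sn, of "x - y"] subspace_neg[OF sub, of "x - y"]
        subspace_neg[OF sub, of "y - x"]
      by (auto simp: zero_ext_def)
    show "zero_ext V q (x - y) = 0 \<longleftrightarrow> x = y" if "x \<in> V" "y \<in> V" for x y
      using subspace_diff[OF sub that] ne[of "x - y"] seminorm_on_0[OF vs sub sn]
      by (auto simp: zero_ext_def)
    show "zero_ext V q (x - z) \<le> zero_ext V q (x - y) + zero_ext V q (y - z)"
      if "x \<in> V" "y \<in> V" "z \<in> V" for x y z
    proof -
      have "q ((x - y) + (y - z)) \<le> q (x - y) + q (y - z)"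
        using sn subspace_diff[OF sub] that unfolding seminorm_on_def by blast
      then show ?thesis using subspace_diff[OF sub] that by (simp add: zero_ext_def)
    qed
  qed
qed

lemma Banach_on_convergent:
  assumes vs: "vector_space s" and V: "Banach_on s V q" and \<sigma>: "\<And>n. \<sigma> n \<in> V"
    and le: "\<And>m n. n \<le> m \<Longrightarrow> q (\<sigma> m - \<sigma> n) \<le> c n" and c: "c \<longlonglongrightarrow> 0"
  shows "\<exists>x\<in>V. (\<lambda>n. q (\<sigma> n - x)) \<longlonglongrightarrow> 0"
proof -
  interpret vector_space s by fact
  interpret M: Metric_space V "\<lambda>x y. zero_ext V q (x - y)"
    by (rule Banach_on_Metric_space[OF vs V])
  have sub: "subspace V" and comp: "M.mcomplete" using V by (auto simp: Banach_on_def)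
  have ze: "zero_ext V q (x - y) = q (x - y)" if "x \<in> V" "y \<in> V" for x y
    using subspace_diff[OF sub that] by (simp add: zero_ext_def)
  have "M.MCauchy \<sigma>"
    unfolding M.MCauchy_def
  proof (intro conjI allI impI)
    fix \<epsilon> :: real assume "\<epsilon> > 0"
    with c obtain N where N: "\<And>n. N \<le> n \<Longrightarrow> c n < \<epsilon>"
      by (metis (mono_tags, lifting) eventually_sequentially order_tendstoD(2))
    have *: "zero_ext V q (\<sigma> m - \<sigma> n) < \<epsilon>" if "N \<le> n" "n \<le> m" for m n
      using le[OF that(2)] N[OF that(1)] ze[OF \<sigma> \<sigma>, of m n] by linarith
    have "zero_ext V q (\<sigma> n - \<sigma> n') < \<epsilon>" if "N \<le> n" "N \<le> n'" for n n'
      using *[of n n'] *[of n' n] that M.commute[of "\<sigma> n" "\<sigma> n'"] by (cases "n \<le> n'") auto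
    then show "\<exists>N. \<forall>n n'. N \<le> n \<longrightarrow> N \<le> n' \<longrightarrow> zero_ext V q (\<sigma> n - \<sigma> n') < \<epsilon>" by blast
  qed (use \<sigma> in auto)
  then obtain x where "limitin M.mtopology \<sigma> x sequentially"
    using comp unfolding M.mcomplete_def by blast
  then have "x \<in> V" "(\<lambda>n. zero_ext V q (\<sigma> n - x)) \<longlonglongrightarrow> 0"
    by (auto simp: M.limitin_metric_dist_null)
  then show ?thesis using ze[OF \<sigma>] by auto
qed

text \<open>\<open>D\<close> is an intersection of closed balls around 0, one for each seminorm,
  hence closed, bounded and absolutely convex, and local completeness applies to it. Prescribing all
  radii \<open>M q\<close> simultaneously gives one Banach space whose gauge controls every
  seminorm.\<close>

lemma seminorm_polar_locally_complete:
  fixes s :: "'k::real_normed_field \<Rightarrow> 'e::ab_group_add \<Rightarrow> 'e"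
  assumes vs: "vector_space s" and P: "directed_seminorms s UNIV P"
    and lc: "locally_complete s P" and M: "\<And>q. q \<in> P \<Longrightarrow> 0 \<le> M q"
  defines "D \<equiv> {x. \<forall>q\<in>P. q x \<le> M q}"
  shows "Banach_on s (gauge_span s D) (Minkowski_gauge s D)"
proof -
  interpret vector_space s by fact
  have sn: "seminorm_on s UNIV q" if "q \<in> P" for q using P that by (auto simp: directed_seminorms_def)
  have add: "q (x + y) \<le> q x + q y" and sc: "q (s a x) = norm a * q x" and nonneg: "0 \<le> q x"
    if "q \<in> P" for q x y a using sn[OF that] by (auto simp: seminorm_on_def)
  have q0: "q 0 = 0" if "q \<in> P" for q
    using seminorm_on_0[OF vs subspace_UNIV sn[OF that]] .
  have "P \<noteq> {}" using P by (auto simp: directed_seminorms_def)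
  then have top: "topspace (seminorm_topology UNIV P) = UNIV"
    using topspace_seminorm_topology[OF vs subspace_UNIV] sn by blast
  have "openin (seminorm_topology UNIV P) (- D)"
  proof (subst openin_subopen, intro ballI)
    fix x assume "x \<in> - D"
    then obtain q where q: "q \<in> P" "M q < q x" by (auto simp: D_def not_le)
    have "{y \<in> UNIV. q (y - x) < q x - M q} \<subseteq> - D"
    proof
      fix y assume "y \<in> {y \<in> UNIV. q (y - x) < q x - M q}"
      moreover have "q x \<le> q (x - y) + q y" using add[OF q(1), of "x - y" y] by simp
      moreover have "q (x - y) = q (y - x)"
        using seminorm_on_minus[OF vs subspace_UNIV sn[OF q(1)], of "y - x"] by simp
      ultimately have "M q < q y" by simp
      then show "y \<in> - D" using q(1) by (auto simp: D_def not_le)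
    qed
    moreover have "openin (seminorm_topology UNIV P) {y \<in> UNIV. q (y - x) < q x - M q}"
      using q by (intro openin_seminorm_ball) auto
    ultimately show "\<exists>T. openin (seminorm_topology UNIV P) T \<and> x \<in> T \<and> T \<subseteq> - D"
      using q q0[OF q(1)] by (intro exI[of _ "{y \<in> UNIV. q (y - x) < q x - M q}"]) auto
  qed
  then have "closedin (seminorm_topology UNIV P) D"
    by (simp add: closedin_def top Compl_eq_Diff_UNIV)
  moreover have zero: "0 \<in> D" using M q0 unfolding D_def by fastforce
  moreover from zero have "D \<noteq> {}" by blast
  moreover have "bounded_wrt P D" by (auto simp: bounded_wrt_def D_def)
  moreover have "absolutely_convex s D"
    unfolding absolutely_convex_def
  proof (intro ballI allI impI)
    fix x y and a b :: 'k assume xy: "x \<in> D" "y \<in> D" and ab: "norm a + norm b \<le> 1"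
    have "q (s a x + s b y) \<le> M q" if q: "q \<in> P" for q
    proof -
      have "q (s a x + s b y) \<le> norm a * q x + norm b * q y"
        using add[OF q, of "s a x" "s b y"] by (simp add: sc[OF q])
      also have "\<dots> \<le> norm a * M q + norm b * M q"
        using xy q by (intro add_mono mult_left_mono) (auto simp: D_def)
      also have "\<dots> = (norm a + norm b) * M q" by (simp add: algebra_simps)
      also have "\<dots> \<le> M q" using ab M[OF q] by (simp add: mult_left_le_one_le)
      finally show ?thesis .
    qed
    then show "s a x + s b y \<in> D" by (simp add: D_def)
  qed
  ultimately show ?thesis using lc unfolding locally_complete_def by blast
qed

text \<open>The partial sums are Cauchy for the gauge of \<open>D\<close>, whose span is complete.
  Convergence in the gauge implies convergence in every \<open>q\<close>, because \<open>q x\<close>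
  is at most the gauge of \<open>x\<close> times \<open>M q\<close>. The factor 2 is the sum of the
  geometric series.\<close>

lemma locally_complete_series:
  fixes s :: "'k::real_normed_field \<Rightarrow> 'e::ab_group_add \<Rightarrow> 'e"
  assumes vs: "vector_space s" and P: "directed_seminorms s UNIV P"
    and lc: "locally_complete s P"
    and M: "\<And>q. q \<in> P \<Longrightarrow> 0 \<le> M q" and d: "\<And>k q. q \<in> P \<Longrightarrow> q (d k) \<le> M q"
  shows "\<exists>e. \<forall>q\<in>P. (\<lambda>n. q ((\<Sum>k<n. s (of_real ((1 / 2) ^ k)) (d k)) - e)) \<longlonglongrightarrow> 0 \<and> q e \<le> 2 * M q"
proof -
  interpret vector_space s by fact
  define D where "D = {x. \<forall>q\<in>P. q x \<le> M q}"
  define \<sigma> where "\<sigma> n = (\<Sum>k<n. s (of_real ((1 / 2) ^ k)) (d k))" for n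
  let ?V = "gauge_span s D" and ?g = "Minkowski_gauge s D"
  have ban: "Banach_on s ?V ?g"
    unfolding D_def by (rule seminorm_polar_locally_complete[OF vs P lc M])
  have sn: "seminorm_on s UNIV q" if "q \<in> P" for q using P that by (auto simp: directed_seminorms_def)
  have add: "q (x + y) \<le> q x + q y" and sc: "q (s a x) = norm a * q x" and nonneg: "0 \<le> q x"
    if "q \<in> P" for q x y a using sn[OF that] by (auto simp: seminorm_on_def)
  have q0: "q 0 = 0" if "q \<in> P" for q
    using seminorm_on_0[OF vs subspace_UNIV sn[OF that]] .
  have in_scaled: "x \<in> s (of_real t) ` D \<longleftrightarrow> (\<forall>q\<in>P. q x \<le> t * M q)" if t: "0 < t" for t x
  proof
    assume "x \<in> s (of_real t) ` D"
    then obtain y where "x = s (of_real t) y" "y \<in> D" by blast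
    then show "\<forall>q\<in>P. q x \<le> t * M q" using t by (auto simp: sc D_def)
  next
    assume x: "\<forall>q\<in>P. q x \<le> t * M q"
    have "q (s (of_real (1 / t)) x) \<le> M q" if "q \<in> P" for q
      unfolding sc[OF that] norm_of_real using x that t by (auto simp: field_simps)
    then have "s (of_real (1 / t)) x \<in> D" by (simp add: D_def)
    moreover have "x = s (of_real t) (s (of_real (1 / t)) x)" using t by simp
    ultimately show "x \<in> s (of_real t) ` D" by blast
  qed
  have span: "x \<in> ?V" if t: "0 < t" and x: "\<forall>q\<in>P. q x \<le> t * M q" for x t
  proof -
    obtain n :: nat where n: "t \<le> real n" using real_arch_simple by blast
    have "\<forall>q\<in>P. q x \<le> real n * M q"
      using x n M by (meson mult_right_mono order_trans)
    then have "x \<in> s (of_real (real n)) ` D" using t n by (subst in_scaled) auto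
    then show ?thesis unfolding gauge_span_def by auto
  qed
  have gauge_le: "?g x \<le> t" if "0 < t" "\<forall>q\<in>P. q x \<le> t * M q" for x t
    unfolding Minkowski_gauge_def
    by (rule cInf_lower) (use that in_scaled in \<open>auto intro!: bdd_belowI[of _ 0]\<close>)
  have le_gauge: "q x \<le> ?g x * M q" if q: "q \<in> P" and x: "x \<in> ?V" for q x
  proof -
    define T where "T = {t. 0 < t \<and> x \<in> s (of_real t) ` D}"
    have T: "q x \<le> t * M q" if "t \<in> T" for t using that in_scaled q by (auto simp: T_def)
    obtain n y where n: "x = s (of_nat n) y" "y \<in> D" using x by (auto simp: gauge_span_def)
    \<comment> \<open>\<open>Suc n\<close> rather than \<open>n\<close>: the multiple in
      \<open>gauge_span\<close> may be 0, whereas the gauge admits only positive factors.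
      Nonemptiness of \<open>T\<close> makes its infimum meaningful.\<close>
    have "real (Suc n) \<in> T"
    proof -
      have "q' x \<le> real (Suc n) * M q'" if "q' \<in> P" for q'
      proof -
        have "q' x \<le> real n * M q'"
          unfolding n(1) sc[OF that] using n(2) that by (auto simp: D_def intro: mult_left_mono)
        also have "\<dots> \<le> real (Suc n) * M q'" using M[OF that] by (intro mult_right_mono) auto
        finally show ?thesis .
      qed
      then show ?thesis unfolding T_def using in_scaled[of "real (Suc n)" x] by auto
    qed
    then have "T \<noteq> {}" by blast
    show ?thesis
    proof (cases "M q = 0")
      case True
      then show ?thesis using T \<open>T \<noteq> {}\<close> by force
    next
      case False
      then have "M q > 0" using M[OF q] by simp
      then have "q x / M q \<le> Inf T"
        using \<open>T \<noteq> {}\<close> T by (intro cInf_greatest) (auto simp: field_simps)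
      then show ?thesis using \<open>M q > 0\<close> by (simp add: Minkowski_gauge_def T_def field_simps)
    qed
  qed
  \<comment> \<open>The exact value of the geometric sum is kept so that the induction closes;
    \<open>diff'\<close> then drops the term depending on \<open>m\<close>.\<close>
  have diff: "q (\<sigma> m - \<sigma> n) \<le> (2 * (1 / 2) ^ n - 2 * (1 / 2) ^ m) * M q" if q: "q \<in> P" and "n \<le> m" for q m n
    using \<open>n \<le> m\<close>
  proof (induction rule: dec_induct)
    case base
    then show ?case using q0[OF q] by simp
  next
    case (step m)
    have "\<sigma> (Suc m) - \<sigma> n = (\<sigma> m - \<sigma> n) + s (of_real ((1 / 2) ^ m)) (d m)"
      by (simp add: \<sigma>_def)
    then have "q (\<sigma> (Suc m) - \<sigma> n) \<le> q (\<sigma> m - \<sigma> n) + norm (of_real ((1 / 2) ^ m) :: 'k) * q (d m)"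
      using add[OF q] sc[OF q] by metis
    also have "\<dots> \<le> (2 * (1 / 2) ^ n - 2 * (1 / 2) ^ m) * M q + (1 / 2) ^ m * M q"
      unfolding norm_of_real using step.IH d[OF q] by (intro add_mono) (auto intro!: mult_left_mono)
    also have "\<dots> = (2 * (1 / 2) ^ n - 2 * (1 / 2) ^ Suc m) * M q"
      by (simp add: algebra_simps)
    finally show ?case .
  qed
  have diff': "q (\<sigma> m - \<sigma> n) \<le> 2 * (1 / 2) ^ n * M q" if q: "q \<in> P" and "n \<le> m" for q m n
  proof -
    have "0 \<le> 2 * (1 / 2) ^ m * M q" using M[OF q] by simp
    then show ?thesis using diff[OF that] by (simp add: algebra_simps)
  qed
  have \<sigma>_le: "q (\<sigma> n) \<le> 2 * M q" if "q \<in> P" for q n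
    using diff'[OF that, of 0 n] by (simp add: \<sigma>_def)
  have "\<exists>e\<in>?V. (\<lambda>n. ?g (\<sigma> n - e)) \<longlonglongrightarrow> 0"
  proof (rule Banach_on_convergent[OF vs ban])
    show "\<sigma> n \<in> ?V" for n using \<sigma>_le by (intro span[of 2]) auto
    show "?g (\<sigma> m - \<sigma> n) \<le> 2 * (1 / 2) ^ n" if "n \<le> m" for m n
      using diff'[OF _ that] by (intro gauge_le) auto
    show "(\<lambda>n. 2 * (1 / 2) ^ n :: real) \<longlonglongrightarrow> 0"
      by (intro tendsto_mult_right_zero LIMSEQ_power_zero) auto
  qed
  then obtain e where e: "e \<in> ?V" "(\<lambda>n. ?g (\<sigma> n - e)) \<longlonglongrightarrow> 0" by blast
  have "(\<lambda>n. q (\<sigma> n - e)) \<longlonglongrightarrow> 0 \<and> q e \<le> 2 * M q" if q: "q \<in> P" for q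
  proof
    have V: "\<sigma> n - e \<in> ?V" for n
    proof -
      have "\<sigma> n \<in> ?V" using \<sigma>_le by (intro span[of 2]) auto
      then show ?thesis using e(1) ban subspace_diff by (auto simp: Banach_on_def)
    qed
    show lim: "(\<lambda>n. q (\<sigma> n - e)) \<longlonglongrightarrow> 0"
    proof (rule tendsto_sandwich[of "\<lambda>_. 0"])
      show "(\<lambda>n. ?g (\<sigma> n - e) * M q) \<longlonglongrightarrow> 0" using e(2) by (rule tendsto_mult_left_zero)
    qed (use nonneg[OF q] le_gauge[OF q V] in auto)
    have "q e \<le> 2 * M q + q (\<sigma> n - e)" for n
    proof -
      have "q e \<le> q (\<sigma> n) + q (e - \<sigma> n)" using add[OF q, of "\<sigma> n" "e - \<sigma> n"] by simp
      also have "q (e - \<sigma> n) = q (\<sigma> n - e)"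
        using seminorm_on_minus[OF vs subspace_UNIV sn[OF q], of "\<sigma> n - e"] by simp
      finally show ?thesis using \<sigma>_le[OF q, of n] by simp
    qed
    moreover have "(\<lambda>n. 2 * M q + q (\<sigma> n - e)) \<longlonglongrightarrow> 2 * M q"
      using tendsto_add[OF tendsto_const[of "2 * M q"] lim] by simp
    ultimately show "q e \<le> 2 * M q" by (meson LIMSEQ_le_const)
  qed
  then show ?thesis unfolding \<sigma>_def by blast
qed

section \<open>Representation of functionals\<close>

text \<open>\<open>\<Phi>\<close> consists of the representable functionals, and \<open>dom\<close>
  says that up to the factor \<open>C\<close> they dominate the whole polar at each point of
  \<open>B\<close>. By \<open>dual_approximation\<close>, \<open>y\<close> is then \<open>C\<close>
  times a geometric series in \<open>\<Phi>\<close>. The representing elements obey common bounds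
  \<open>M\<close>, so \<open>locally_complete_series\<close> sums them in \<open>E\<close>.\<close>

lemma weak_functional_representation:
  fixes s :: "'k::real_or_complex \<Rightarrow> 'e::ab_group_add \<Rightarrow> 'e"
    and t :: "'k \<Rightarrow> 'v::ab_group_add \<Rightarrow> 'v"
  assumes vs: "vector_space s" and P: "directed_seminorms s UNIV P" and lc: "locally_complete s P"
    and M: "\<And>q. q \<in> P \<Longrightarrow> 0 \<le> M q"
    and vt: "vector_space t" and B: "compactin X B" "absolutely_convex t B"
    and G: "G \<subseteq> dual s (seminorm_topology UNIV P)"
    and \<gamma>: "\<And>e'. e' \<in> G \<Longrightarrow> \<exists>r b. b \<in> B \<and> \<gamma> e' = t (of_real r) b"
    and C: "0 < C"
    and y: "y \<in> dual_polar t X B"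
  defines "\<Phi> \<equiv> {z \<in> dual t X. \<exists>d. (\<forall>q\<in>P. q d \<le> M q) \<and> (\<forall>e'\<in>G. e' d = z (\<gamma> e'))}"
  assumes dom: "\<And>b \<epsilon> y. \<lbrakk>b \<in> B; 0 < \<epsilon>; y \<in> dual_polar t X B\<rbrakk> \<Longrightarrow> \<exists>z\<in>\<Phi>. norm (y b) \<le> C * norm (z b) + \<epsilon>"
  shows "\<exists>e. (\<forall>q\<in>P. q e \<le> 2 * C * M q) \<and> (\<forall>e'\<in>G. e' e = y (\<gamma> e'))"
proof -
  interpret E: vector_space s by fact
  interpret V: vector_space t by fact
  interpret F: vector_space "pointwise (*) :: 'k \<Rightarrow> ('v \<Rightarrow> 'k) \<Rightarrow> _"
    by (rule vector_space_pointwise_field)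
  have sn: "seminorm_on s UNIV q" if "q \<in> P" for q using P that by (auto simp: directed_seminorms_def)
  have add: "q (x + y) \<le> q x + q y" and sc: "q (s a x) = norm a * q x" and nonneg: "0 \<le> q x"
    if "q \<in> P" for q x y a using sn[OF that] by (auto simp: seminorm_on_def)
  have q0: "q 0 = 0" if "q \<in> P" for q
    using seminorm_on_0[OF vs E.subspace_UNIV sn[OF that]] .
  have "P \<noteq> {}" using P by (auto simp: directed_seminorms_def)
  then have top: "topspace (seminorm_topology UNIV P) = UNIV"
    using topspace_seminorm_topology[OF vs E.subspace_UNIV] sn by blast
  have Gd: "e' \<in> dual s (seminorm_topology UNIV P)" if "e' \<in> G" for e' using G that by blast
  have G_add: "e' (x + z) = e' x + e' z" and G_scale: "e' (s a x) = a * e' x"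
    and G_diff: "e' (x - z) = e' x - e' z" if "e' \<in> G" for e' x z a
    using dual_add[OF Gd[OF that]] dual_scale[OF Gd[OF that]] dual_diff[OF vs Gd[OF that]]
    by (auto simp: top)
  have topB: "b \<in> topspace X" if "b \<in> B" for b using B(1) that compactin_subset_topspace by blast
  have polar: "z \<in> dual t X" "norm (z b) \<le> 1" if "z \<in> dual_polar t X B" "b \<in> B" for z b
    using that by (auto simp: dual_polar_def)
  have yd: "y \<in> dual t X" using y by (simp add: dual_polar_def)
  note subd = subspace_dual[OF vt dual_subspace_topspace[OF yd]]
  have \<Phi>: "\<Phi> \<subseteq> dual t X" by (auto simp: \<Phi>_def)
  have "0 \<in> \<Phi>"
  proof -
    have "q 0 \<le> M q" if "q \<in> P" for q using q0[OF that] M[OF that] by simp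
    then show ?thesis
      using F.subspace_0[OF subd] dual_0[OF vs Gd] by (auto simp: \<Phi>_def intro!: exI[of _ 0])
  qed
  then have \<Phi>ne: "\<Phi> \<noteq> {}" by blast
  have \<Phi>ac: "absolutely_convex (pointwise (*)) \<Phi>"
    unfolding absolutely_convex_def
  proof (intro ballI allI impI)
    fix z1 z2 and a b :: 'k assume z: "z1 \<in> \<Phi>" "z2 \<in> \<Phi>" and ab: "norm a + norm b \<le> 1"
    obtain d1 where d1: "\<And>q. q \<in> P \<Longrightarrow> q d1 \<le> M q" "\<And>e'. e' \<in> G \<Longrightarrow> e' d1 = z1 (\<gamma> e')"
      using z(1) unfolding \<Phi>_def by blast
    obtain d2 where d2: "\<And>q. q \<in> P \<Longrightarrow> q d2 \<le> M q" "\<And>e'. e' \<in> G \<Longrightarrow> e' d2 = z2 (\<gamma> e')"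
      using z(2) unfolding \<Phi>_def by blast
    let ?z = "pointwise (*) a z1 + pointwise (*) b z2"
    have "?z \<in> dual t X"
      using z \<Phi> by (intro F.subspace_add[OF subd] F.subspace_scale[OF subd]) auto
    moreover have "q (s a d1 + s b d2) \<le> M q" if q: "q \<in> P" for q
    proof -
      have "q (s a d1 + s b d2) \<le> norm a * q d1 + norm b * q d2"
        using add[OF q, of "s a d1" "s b d2"] by (simp add: sc[OF q])
      also have "\<dots> \<le> norm a * M q + norm b * M q"
        using d1 d2 q by (intro add_mono mult_left_mono) auto
      also have "\<dots> = (norm a + norm b) * M q" by (simp add: algebra_simps)
      also have "\<dots> \<le> M q" using ab M[OF q] by (simp add: mult_left_le_one_le)
      finally show ?thesis .
    qed
    moreover have "e' (s a d1 + s b d2) = ?z (\<gamma> e')" if "e' \<in> G" for e'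
      using d1(2) d2(2) that by (simp add: G_add G_scale pointwise_def)
    ultimately show "?z \<in> \<Phi>" by (auto simp: \<Phi>_def)
  qed
  \<comment> \<open>Approximating \<open>w / C\<close> within \<open>1 / (2 * C)\<close> leaves a
    remainder \<open>w - C z\<close> in half the polar. Doubling it returns to the polar, so the
    step can be iterated.\<close>
  have "\<exists>z\<in>\<Phi>. pointwise (*) 2 (w - pointwise (*) (of_real C) z) \<in> dual_polar t X B"
    if w: "w \<in> dual_polar t X B" for w
  proof -
    have wd: "w \<in> dual t X" using w by (simp add: dual_polar_def)
    let ?w = "pointwise (*) (of_real (1 / C)) w"
    have "\<exists>z\<in>\<Phi>. \<forall>b\<in>B. norm (?w b - z b) < 1 / (2 * C)"
    proof (rule dual_approximation[OF vt B \<Phi> \<Phi>ne \<Phi>ac F.subspace_scale[OF subd wd]])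
      fix b \<epsilon> assume "b \<in> B" "0 < (\<epsilon>::real)"
      then obtain z where "z \<in> \<Phi>" "norm (w b) \<le> C * norm (z b) + C * \<epsilon>"
        using dom[of b "C * \<epsilon>" w] w C by auto
      then show "\<exists>z\<in>\<Phi>. norm (?w b) \<le> norm (z b) + \<epsilon>"
        using C by (intro bexI[of _ z]) (auto simp: pointwise_def norm_mult norm_divide field_simps)
    qed (use C in auto)
    then obtain z where z: "z \<in> \<Phi>" "\<And>b. b \<in> B \<Longrightarrow> norm (?w b - z b) < 1 / (2 * C)" by blast
    let ?v = "pointwise (*) 2 (w - pointwise (*) (of_real C) z)"
    have "norm (?v b) \<le> 1" if "b \<in> B" for b
    proof -
      have "?v b = of_real (2 * C) * (?w b - z b)"
        using C by (simp add: pointwise_def algebra_simps)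
      then have "norm (?v b) = 2 * C * norm (?w b - z b)"
        using C by (simp add: norm_mult)
      also have "\<dots> \<le> 2 * C * (1 / (2 * C))"
        using z(2)[OF that] C by (intro mult_left_mono) auto
      finally show ?thesis using C by simp
    qed
    moreover have "?v \<in> dual t X"
      using wd z(1) \<Phi> by (intro F.subspace_scale[OF subd] F.subspace_diff[OF subd]) auto
    ultimately show ?thesis using z(1) unfolding dual_polar_def by blast
  qed
  then obtain \<zeta> where \<zeta>: "\<And>w. w \<in> dual_polar t X B \<Longrightarrow> \<zeta> w \<in> \<Phi>"
      "\<And>w. w \<in> dual_polar t X B \<Longrightarrow> pointwise (*) 2 (w - pointwise (*) (of_real C) (\<zeta> w)) \<in> dual_polar t X B"
    by metis
  \<comment> \<open>\<open>Y n\<close> is the remainder after \<open>n\<close> approximation steps, rescaled by \<open>2 ^ n\<close>.\<close>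
  define Y where "Y n = ((\<lambda>w. pointwise (*) 2 (w - pointwise (*) (of_real C) (\<zeta> w))) ^^ n) y" for n
  have Y: "Y n \<in> dual_polar t X B" for n
    by (induction n) (auto simp: Y_def y \<zeta>)
  define z where "z n = \<zeta> (Y n)" for n
  have z: "z n \<in> \<Phi>" for n using \<zeta>(1)[OF Y] by (simp add: z_def)
  have y_eq: "y v = of_real C * (\<Sum>k<n. of_real ((1 / 2) ^ k) * z k v) + of_real ((1 / 2) ^ n) * Y n v" for n v
  proof (induction n)
    case 0
    then show ?case by (simp add: Y_def)
  next
    case (Suc n)
    have "Y (Suc n) v = 2 * (Y n v - of_real C * z n v)"
      by (simp add: Y_def z_def pointwise_def)
    then have "Y n v = of_real C * z n v + Y (Suc n) v / 2"
      by (simp add: diff_divide_distrib)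
    then show ?case by (subst Suc, subst \<open>Y n v = _\<close>) (simp add: algebra_simps)
  qed
  have "\<exists>d. (\<forall>q\<in>P. q d \<le> M q) \<and> (\<forall>e'\<in>G. e' d = z n (\<gamma> e'))" for n
    using z[of n] by (simp add: \<Phi>_def)
  then obtain d where d: "\<And>n q. q \<in> P \<Longrightarrow> q (d n) \<le> M q" "\<And>n e'. e' \<in> G \<Longrightarrow> e' (d n) = z n (\<gamma> e')"
    by metis
  define \<sigma> where "\<sigma> n = (\<Sum>k<n. s (of_real ((1 / 2) ^ k)) (d k))" for n
  obtain e where e: "\<And>q. q \<in> P \<Longrightarrow> (\<lambda>n. q (\<sigma> n - e)) \<longlonglongrightarrow> 0" "\<And>q. q \<in> P \<Longrightarrow> q e \<le> 2 * M q"
    using locally_complete_series[of s P M d] vs P lc M d(1) unfolding \<sigma>_def by blast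
  have "q (s (of_real C) e) \<le> 2 * C * M q" if q: "q \<in> P" for q
    using mult_left_mono[OF e(2)[OF q], of C] C by (simp add: sc[OF q])
  moreover have "e' (s (of_real C) e) = y (\<gamma> e')" if e': "e' \<in> G" for e'
  proof -
    \<comment> \<open>A single seminorm controls \<open>e'\<close>, so convergence of the partial
      sums in that seminorm passes to their images under \<open>e'\<close>.\<close>
    obtain q c where q: "q \<in> P" "\<And>x. norm (e' x) \<le> c * q x"
      using dual_bound[OF vs P Gd[OF e']] by blast
    have "(\<lambda>n. e' (\<sigma> n) - e' e) \<longlonglongrightarrow> 0"
    proof (rule Lim_null_comparison)
      show "\<forall>\<^sub>F n in sequentially. norm (e' (\<sigma> n) - e' e) \<le> c * q (\<sigma> n - e)"
        using q(2) by (simp flip: G_diff[OF e'])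
      show "(\<lambda>n. c * q (\<sigma> n - e)) \<longlonglongrightarrow> 0" using e(1)[OF q(1)] by (rule tendsto_mult_right_zero)
    qed
    then have "(\<lambda>n. e' (\<sigma> n)) \<longlonglongrightarrow> e' e" by (simp add: LIM_zero_iff)
    then have lim1: "(\<lambda>n. of_real C * e' (\<sigma> n)) \<longlonglongrightarrow> of_real C * e' e" by (intro tendsto_mult_left)
    \<comment> \<open>All \<open>Y n\<close> are bounded by 1 on \<open>B\<close>, hence by the
      fixed number \<open>\<bar>r\<bar>\<close> at \<open>\<gamma> e'\<close>; the factor
      \<open>(1 / 2) ^ n\<close> then makes the remainder vanish.\<close>
    obtain r b where rb: "b \<in> B" "\<gamma> e' = t (of_real r) b" using \<gamma>[OF e'] by blast
    have "e' (\<sigma> n) = (\<Sum>k<n. of_real ((1 / 2) ^ k) * z k (\<gamma> e'))" for n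
      by (induction n) (use dual_0[OF vs Gd[OF e']] in
        \<open>auto simp: \<sigma>_def G_add[OF e'] G_scale[OF e'] d(2)[OF e']\<close>)
    then have eq: "of_real C * e' (\<sigma> n) - y (\<gamma> e') = - (of_real ((1 / 2) ^ n) * Y n (\<gamma> e'))" for n
      using y_eq[of "\<gamma> e'" n] by simp
    have "(\<lambda>n. of_real C * e' (\<sigma> n) - y (\<gamma> e')) \<longlonglongrightarrow> 0"
    proof (rule Lim_null_comparison)
      have "norm (Y n (\<gamma> e')) \<le> \<bar>r\<bar>" for n
      proof -
        have "Y n (\<gamma> e') = of_real r * Y n b"
          unfolding rb(2) by (rule dual_scale[OF polar(1)[OF Y rb(1)] topB[OF rb(1)]])
        then show ?thesis using polar(2)[OF Y rb(1), of n] by (simp add: norm_mult mult_left_le)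
      qed
      then have "norm (of_real C * e' (\<sigma> n) - y (\<gamma> e')) \<le> (1 / 2) ^ n * \<bar>r\<bar>" for n
        unfolding eq norm_minus_cancel norm_mult norm_of_real by (simp add: mult_left_mono)
      then show "\<forall>\<^sub>F n in sequentially. norm (of_real C * e' (\<sigma> n) - y (\<gamma> e')) \<le> (1 / 2) ^ n * \<bar>r\<bar>"
        by simp
      show "(\<lambda>n. (1 / 2) ^ n * \<bar>r\<bar>) \<longlonglongrightarrow> 0"
        by (intro tendsto_mult_left_zero LIMSEQ_power_zero) auto
    qed
    then have "(\<lambda>n. of_real C * e' (\<sigma> n)) \<longlonglongrightarrow> y (\<gamma> e')" by (simp add: LIM_zero_iff)
    from LIMSEQ_unique[OF lim1 this] show ?thesis by (simp add: G_scale[OF e'])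
  qed
  ultimately show ?thesis by blast
qed

section \<open>The dual with uniform convergence on compact absolutely convex sets\<close>

lemma bdd_above_norm_compactin:
  fixes y :: "'v \<Rightarrow> 'k::real_normed_vector"
  assumes "compactin X K" "continuous_map X euclidean y"
  shows "bdd_above ((\<lambda>x. norm (y x)) ` K)"
proof -
  have "compact ((\<lambda>x. norm (y x)) ` K)"
    using image_compactin[OF assms(1) continuous_map_norm[OF assms(2)]] by simp
  then show ?thesis by (intro bounded_imp_bdd_above compact_imp_bounded)
qed

lemma seminorm_on_SUP_compactin:
  fixes t :: "'k::real_normed_field \<Rightarrow> 'v::ab_group_add \<Rightarrow> 'v"
  assumes K: "compactin X K" "K \<noteq> {}"
  shows "seminorm_on (pointwise (*)) (dual t X) (\<lambda>y. SUP x\<in>K. norm (y x))"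
proof -
  have upper: "norm (y x) \<le> (SUP x\<in>K. norm (y x))" if "y \<in> dual t X" "x \<in> K" for y x
    using that bdd_above_norm_compactin[OF K(1) dual_continuous] by (intro cSUP_upper) auto
  have nonneg: "0 \<le> (SUP x\<in>K. norm (y x))" if "y \<in> dual t X" for y
  proof -
    obtain x where "x \<in> K" using K(2) by blast
    with upper[OF that this] show ?thesis by (meson norm_ge_zero order_trans)
  qed
  have "(SUP x\<in>K. norm (pointwise (*) a y x)) = norm a * (SUP x\<in>K. norm (y x))"
    if y: "y \<in> dual t X" for a y
  proof (cases "a = 0")
    case False
    show ?thesis
    proof (rule cSup_eq_non_empty)
      show "x \<le> norm a * (SUP x\<in>K. norm (y x))"
        if "x \<in> (\<lambda>x. norm (pointwise (*) a y x)) ` K" for x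
        using that upper[OF y] by (auto simp: pointwise_def norm_mult intro!: mult_left_mono)
      show "norm a * (SUP x\<in>K. norm (y x)) \<le> w"
        if "\<And>x. x \<in> (\<lambda>x. norm (pointwise (*) a y x)) ` K \<Longrightarrow> x \<le> w" for w
      proof -
        have "(SUP x\<in>K. norm (y x)) \<le> w / norm a"
          using that False K(2) by (intro cSUP_least) (auto simp: pointwise_def norm_mult field_simps)
        then show ?thesis using False by (simp add: field_simps)
      qed
    qed (use K in auto)
  qed (use K in \<open>auto simp: pointwise_def\<close>)
  moreover have "(SUP x\<in>K. norm ((y + z) x)) \<le> (SUP x\<in>K. norm (y x)) + (SUP x\<in>K. norm (z x))"
    if "y \<in> dual t X" "z \<in> dual t X" for y z
    using K(2) by (intro cSUP_least)
      (auto intro!: order_trans[OF norm_triangle_ineq] add_mono upper that)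
  ultimately show ?thesis using nonneg by (auto simp: seminorm_on_def)
qed

lemma topspace_kappa_dual:
  assumes vt: "vector_space t" and X: "module.subspace t (topspace X)"
  shows "topspace (kappa_dual t X) = dual t X"
proof -
  interpret vector_space t by fact
  show ?thesis
    unfolding kappa_dual_def
  proof (rule topspace_seminorm_topology[OF vector_space_pointwise_field subspace_dual[OF vt X]])
    \<comment> \<open>The singleton of 0 shows that the system of seminorms is nonempty; a topology
      generated by no sets would have an empty carrier.\<close>
    have "absolutely_convex t {0}" by (simp add: absolutely_convex_def)
    moreover have "compactin X {0}" using subspace_0[OF X] by simp
    ultimately show "{\<lambda>y. SUP x\<in>K. norm (y x) |K. K \<noteq> {} \<and> compactin X K \<and> absolutely_convex t K} \<noteq> {}"
      by blast
  qed (use seminorm_on_SUP_compactin in blast)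
qed

text \<open>The supremum over \<open>K\<close> is one of the defining seminorms of the topology on
  the dual, so \<open>u\<close> is Lipschitz from it into each \<open>q\<close>. It suffices to
  check preimages of the subbasic balls of the target.\<close>

lemma continuous_map_kappa_dual:
  assumes vt: "vector_space t" and X: "module.subspace t (topspace X)"
    and vs: "vector_space s" and P: "directed_seminorms s UNIV P"
    and K: "compactin X K" "K \<noteq> {}" "absolutely_convex t K"
    and diff: "\<And>y z. \<lbrakk>y \<in> dual t X; z \<in> dual t X\<rbrakk> \<Longrightarrow> u (y - z) = u y - u z"
    and le: "\<And>q. q \<in> P \<Longrightarrow> \<exists>c. \<forall>y\<in>dual t X. q (u y) \<le> c * (SUP x\<in>K. norm (y x))"
  shows "continuous_map (kappa_dual t X) (seminorm_topology UNIV P) u"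
proof -
  interpret E: vector_space s by fact
  interpret F: vector_space "pointwise (*) :: 'a \<Rightarrow> ('b \<Rightarrow> 'a) \<Rightarrow> _"
    by (rule vector_space_pointwise_field)
  let ?p = "\<lambda>y. SUP x\<in>K. norm (y x)"
  note subd = subspace_dual[OF vt X]
  have p: "seminorm_on (pointwise (*)) (dual t X) ?p" by (rule seminorm_on_SUP_compactin[OF K(1,2)])
  have sn: "seminorm_on s UNIV q" if "q \<in> P" for q using P that by (auto simp: directed_seminorms_def)
  have open_pre: "openin (kappa_dual t X) {y \<in> dual t X. q (u y - x) < r}" if q: "q \<in> P" for q x r
  proof (subst openin_subopen, intro ballI)
    fix y assume y: "y \<in> {y \<in> dual t X. q (u y - x) < r}"
    \<comment> \<open>The given constant may be nonpositive; \<open>max c0 1\<close> is a valid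
      bound by which one can divide.\<close>
    obtain c0 where "\<And>y. y \<in> dual t X \<Longrightarrow> q (u y) \<le> c0 * ?p y" using le[OF q] by blast
    moreover have "c0 * ?p y \<le> max c0 1 * ?p y" if "y \<in> dual t X" for y
      using p that by (intro mult_right_mono) (auto simp: seminorm_on_def)
    moreover define c where "c = max c0 1"
    ultimately have c: "c > 0" "\<And>y. y \<in> dual t X \<Longrightarrow> q (u y) \<le> c * ?p y"
      by (auto intro: order_trans)
    define W where "W = {z \<in> dual t X. ?p (z - y) < (r - q (u y - x)) / c}"
    have "openin (kappa_dual t X) W"
      unfolding W_def kappa_dual_def using y K c
      by (intro openin_seminorm_ball[where q = ?p]) auto
    moreover have "y \<in> W"
      using y c seminorm_on_0[OF F.vector_space_axioms subd p] by (simp add: W_def)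
    moreover have "W \<subseteq> {y \<in> dual t X. q (u y - x) < r}"
    proof
      fix z assume z: "z \<in> W"
      have zd: "z \<in> dual t X" "y \<in> dual t X" using z y by (auto simp: W_def)
      have "u z - x = u (z - y) + (u y - x)" using diff[OF zd] by simp
      then have "q (u z - x) \<le> q (u (z - y)) + q (u y - x)"
        using sn[OF q] unfolding seminorm_on_def by (metis UNIV_I)
      also have "q (u (z - y)) \<le> c * ?p (z - y)" using c(2)[OF F.subspace_diff[OF subd zd]] .
      also have "\<dots> < r - q (u y - x)" using z c by (simp add: W_def field_simps)
      finally show "z \<in> {y \<in> dual t X. q (u y - x) < r}" using zd by simp
    qed
    ultimately show "\<exists>T. openin (kappa_dual t X) T \<and> y \<in> T \<and> T \<subseteq> {y \<in> dual t X. q (u y - x) < r}"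
      by blast
  qed
  have "P \<noteq> {}" using P by (auto simp: directed_seminorms_def)
  then have "topspace (seminorm_topology UNIV P) = UNIV"
    using topspace_seminorm_topology[OF vs E.subspace_UNIV] sn by blast
  then have "u ` topspace (kappa_dual t X) \<subseteq> \<Union> {{y \<in> UNIV. q (y - x) < r} |q x r. q \<in> P \<and> x \<in> UNIV \<and> 0 < r}"
    unfolding seminorm_topology_def by simp
  moreover have "openin (kappa_dual t X) (u -` {y \<in> UNIV. q (y - x) < r} \<inter> topspace (kappa_dual t X))"
    if "q \<in> P" for q x r
  proof -
    have "u -` {y \<in> UNIV. q (y - x) < r} \<inter> dual t X = {y \<in> dual t X. q (u y - x) < r}" by auto
    then show ?thesis using open_pre[OF that] by (simp add: topspace_kappa_dual[OF vt X])
  qed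
  ultimately show ?thesis
    unfolding seminorm_topology_def by (intro continuous_on_generated_topo) blast+
qed

text \<open>Since \<open>G\<close> separates points, the element representing \<open>y\<close> is
  unique, which forces linearity of the map sending \<open>y\<close> to it. Scaling \<open>y\<close>
  into the polar of \<open>B\<close> bounds \<open>q (u y)\<close> by a multiple of the supremum of
  \<open>y\<close> over \<open>B\<close>. As \<open>B\<close> is compact and absolutely convex, that
  is continuity on the dual.\<close>

lemma weak_extension_eps_map:
  fixes s :: "'k::real_or_complex \<Rightarrow> 'e::ab_group_add \<Rightarrow> 'e"
    and t :: "'k \<Rightarrow> 'v::ab_group_add \<Rightarrow> 'v"
  assumes vs: "vector_space s" and P: "directed_seminorms s UNIV P" and lc: "locally_complete s P"
    and M: "\<And>q. q \<in> P \<Longrightarrow> 0 \<le> M q"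
    and vt: "vector_space t" and X: "module.subspace t (topspace X)"
    and B: "compactin X B" "absolutely_convex t B" "B \<noteq> {}"
    and G: "separating_subspace s P G"
    and \<gamma>: "\<And>e'. e' \<in> G \<Longrightarrow> \<exists>r b. b \<in> B \<and> \<gamma> e' = t (of_real r) b"
    and C: "0 < C"
    and dom: "\<And>b \<epsilon> y. \<lbrakk>b \<in> B; 0 < \<epsilon>; y \<in> dual_polar t X B\<rbrakk> \<Longrightarrow>
      \<exists>z\<in>dual t X. (\<exists>d. (\<forall>q\<in>P. q d \<le> M q) \<and> (\<forall>e'\<in>G. e' d = z (\<gamma> e'))) \<and>
        norm (y b) \<le> C * norm (z b) + \<epsilon>"
  shows "\<exists>u\<in>eps_maps t X s P. (\<forall>y\<in>dual t X. \<forall>e'\<in>G. e' (u y) = y (\<gamma> e')) \<and>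
    bounded_wrt P (u ` dual_polar t X B)"
proof -
  interpret E: vector_space s by fact
  interpret V: vector_space t by fact
  interpret F: vector_space "pointwise (*) :: 'k \<Rightarrow> ('v \<Rightarrow> 'k) \<Rightarrow> _"
    by (rule vector_space_pointwise_field)
  note subd = subspace_dual[OF vt X]
  let ?p = "\<lambda>y :: 'v \<Rightarrow> 'k. SUP x\<in>B. norm (y x)"
  have p: "seminorm_on (pointwise (*)) (dual t X) ?p" by (rule seminorm_on_SUP_compactin[OF B(1,3)])
  have sn: "seminorm_on s UNIV q" if "q \<in> P" for q using P that by (auto simp: directed_seminorms_def)
  have sc: "q (s a x) = norm a * q x" if "q \<in> P" for q x a using sn[OF that] by (auto simp: seminorm_on_def)
  have "P \<noteq> {}" using P by (auto simp: directed_seminorms_def)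
  then have top: "topspace (seminorm_topology UNIV P) = UNIV"
    using topspace_seminorm_topology[OF vs E.subspace_UNIV] sn by blast
  have Gd: "e' \<in> dual s (seminorm_topology UNIV P)" if "e' \<in> G" for e'
    using G that by (auto simp: separating_subspace_def)
  have G_add: "e' (x + z) = e' x + e' z" and G_scale: "e' (s a x) = a * e' x"
    and G_diff: "e' (x - z) = e' x - e' z" if "e' \<in> G" for e' x z a
    using dual_add[OF Gd[OF that]] dual_scale[OF Gd[OF that]] dual_diff[OF vs Gd[OF that]]
    by (auto simp: top)
  have G_eq: "x = z" if "\<And>e'. e' \<in> G \<Longrightarrow> e' x = e' z" for x z
  proof -
    have "\<forall>e'\<in>G. e' (x - z) = 0" using that by (simp add: G_diff)
    then have "x - z = 0" using G unfolding separating_subspace_def by blast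
    then show ?thesis by simp
  qed
  have rep: "\<exists>e. (\<forall>q\<in>P. q e \<le> 2 * C * M q) \<and> (\<forall>e'\<in>G. e' e = y (\<gamma> e'))"
    if "y \<in> dual_polar t X B" for y
    using G dom
    by (intro weak_functional_representation[OF vs P lc M vt B(1,2) _ \<gamma> C that])
      (auto simp: separating_subspace_def Bex_def)
  have rep': "\<exists>e. (\<forall>q\<in>P. q e \<le> r * (2 * C * M q)) \<and> (\<forall>e'\<in>G. e' e = y (\<gamma> e'))"
    if y: "y \<in> dual t X" and r: "0 < r" "?p y \<le> r" for y r
  proof -
    have "norm (y b) \<le> r" if "b \<in> B" for b
      using cSUP_upper[OF that bdd_above_norm_compactin[OF B(1) dual_continuous[OF y]]] r by simp
    then have "\<forall>b\<in>B. norm (pointwise (*) (of_real (1 / r)) y b) \<le> 1"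
      using r by (simp add: pointwise_def norm_divide)
    then have "pointwise (*) (of_real (1 / r)) y \<in> dual_polar t X B"
      unfolding dual_polar_def using F.subspace_scale[OF subd y] by blast
    from rep[OF this] obtain e where e: "\<And>q. q \<in> P \<Longrightarrow> q e \<le> 2 * C * M q"
      "\<And>e'. e' \<in> G \<Longrightarrow> e' e = of_real (1 / r) * y (\<gamma> e')" by (auto simp: pointwise_def)
    have "q (s (of_real r) e) \<le> r * (2 * C * M q)" if "q \<in> P" for q
      using e(1)[OF that] r by (simp add: sc[OF that])
    moreover have "e' (s (of_real r) e) = y (\<gamma> e')" if "e' \<in> G" for e'
      using r by (simp add: G_scale[OF that] e(2)[OF that])
    ultimately show ?thesis by blast
  qed
  have p_nonneg: "0 \<le> ?p y" if "y \<in> dual t X" for y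
    using p that by (simp add: seminorm_on_def)
  have "\<exists>e. \<forall>e'\<in>G. e' e = y (\<gamma> e')" if "y \<in> dual t X" for y
    using rep'[OF that, of "?p y + 1"] p_nonneg[OF that] by auto
  then obtain u0 where u0: "\<And>y e'. \<lbrakk>y \<in> dual t X; e' \<in> G\<rbrakk> \<Longrightarrow> e' (u0 y) = y (\<gamma> e')" by metis
  \<comment> \<open>Members of \<open>eps_maps\<close> must vanish off the dual. On the dual the
    arbitrary choice \<open>u0\<close> is harmless: identities for \<open>u\<close> are tested
    against \<open>G\<close> through \<open>G_eq\<close>.\<close>
  define u where "u = zero_ext (dual t X) u0"
  have u: "e' (u y) = y (\<gamma> e')" if "y \<in> dual t X" "e' \<in> G" for y e'
    using u0 that by (simp add: u_def zero_ext_def)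
  have u_add: "u (y + z) = u y + u z" if "y \<in> dual t X" "z \<in> dual t X" for y z
    using that F.subspace_add[OF subd that] by (intro G_eq) (simp add: u G_add)
  have u_diff: "u (y - z) = u y - u z" if "y \<in> dual t X" "z \<in> dual t X" for y z
    using that F.subspace_diff[OF subd that] by (intro G_eq) (simp add: u G_diff)
  have u_scale: "u (pointwise (*) a y) = s a (u y)" if "y \<in> dual t X" for a y
    using that F.subspace_scale[OF subd that] by (intro G_eq) (simp add: u G_scale, simp add: pointwise_def)
  have u_le: "q (u y) \<le> r * (2 * C * M q)"
    if y: "y \<in> dual t X" and q: "q \<in> P" and r: "0 < r" "?p y \<le> r" for y q r
  proof -
    obtain e where e: "\<forall>q\<in>P. q e \<le> r * (2 * C * M q)" "\<forall>e'\<in>G. e' e = y (\<gamma> e')"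
      using rep'[OF y r] by blast
    have "u y = e" by (rule G_eq) (simp add: u[OF y] e(2))
    then show ?thesis using e(1) q by simp
  qed
  \<comment> \<open>\<open>?p y\<close> may be zero, so \<open>u_le\<close> is applied with slightly larger radii.\<close>
  have u_le': "q (u y) \<le> (2 * C * M q) * ?p y" if y: "y \<in> dual t X" and q: "q \<in> P" for y q
  proof (rule field_le_epsilon)
    fix \<epsilon> :: real assume \<epsilon>: "\<epsilon> > 0"
    define N where "N = 2 * C * M q"
    have N: "0 \<le> N" using C M[OF q] by (simp add: N_def)
    have "q (u y) \<le> (?p y + \<epsilon> / (N + 1)) * N"
      unfolding N_def
      by (rule u_le[OF y q]) (use \<epsilon> N p_nonneg[OF y] in \<open>auto simp: N_def intro!: add_nonneg_pos divide_pos_pos\<close>)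
    also have "\<dots> = N * ?p y + \<epsilon> * (N / (N + 1))" by (simp add: algebra_simps)
    also have "\<epsilon> * (N / (N + 1)) \<le> \<epsilon> * 1" using N \<epsilon> by (intro mult_left_mono) auto
    finally show "q (u y) \<le> (2 * C * M q) * ?p y + \<epsilon>" by (simp add: N_def)
  qed
  have "continuous_map (kappa_dual t X) (seminorm_topology UNIV P) u"
    by (rule continuous_map_kappa_dual[OF vt X vs P B(1,3,2) u_diff]) (use u_le' in blast)+
  then have "u \<in> eps_maps t X s P"
    unfolding eps_maps_def continuous_linear_maps_def linear_map_on_def topspace_kappa_dual[OF vt X]
    using subd u_add u_scale by (simp add: u_def zero_ext_def)
  moreover have "bounded_wrt P (u ` dual_polar t X B)"
    unfolding bounded_wrt_def
  proof (intro ballI exI)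
    fix q x assume q: "q \<in> P" and "x \<in> u ` dual_polar t X B"
    then obtain y where y: "y \<in> dual_polar t X B" "x = u y" by blast
    have "?p y \<le> 1" using y B(3) by (intro cSUP_least) (auto simp: dual_polar_def)
    then show "q x \<le> 1 * (2 * C * M q)"
      unfolding y(2) using y(1) q by (intro u_le) (auto simp: dual_polar_def)
  qed
  ultimately show ?thesis using u by blast
qed

section \<open>Weighted spaces\<close>

lemma topspace_locally_convex_Hausdorff:
  assumes "vector_space s" "locally_convex_Hausdorff s V X"
  shows "topspace X = V" "module.subspace s V"
  using assms topspace_seminorm_topology[OF assms(1)]
  by (auto simp: locally_convex_Hausdorff_def directed_seminorms_def)

lemma weighted_value_le:
  assumes "f \<in> weighted_space F TK \<nu> {norm}"
  shows "norm (TK f x) * \<nu> x \<le> weighted_seminorm TK \<nu> norm f"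
  unfolding weighted_seminorm_def
  using assms by (intro cSUP_upper) (auto simp: weighted_space_def)

text \<open>Divide by the norm; if the norm is 0, definiteness gives \<open>f = 0\<close> and
  \<open>b = 0\<close> serves.\<close>

lemma weighted_unit_ball_scaled:
  fixes TK :: "('o \<Rightarrow> 'k::real_normed_field) \<Rightarrow> 'w \<Rightarrow> 'k"
  assumes Z: "Banach_on (pointwise (*)) (weighted_space (topspace FK) TK \<nu> {norm}) (weighted_seminorm TK \<nu> norm)"
    and f: "f \<in> weighted_space (topspace FK) TK \<nu> {norm}"
  shows "\<exists>b\<in>weighted_unit_ball FK TK \<nu>. f = pointwise (*) (of_real (weighted_seminorm TK \<nu> norm f)) b"
proof -
  interpret F: vector_space "pointwise (*) :: 'k \<Rightarrow> ('o \<Rightarrow> 'k) \<Rightarrow> _"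
    by (rule vector_space_pointwise_field)
  let ?n = "weighted_seminorm TK \<nu> norm"
  have sub: "F.subspace (weighted_space (topspace FK) TK \<nu> {norm})"
    and sn: "seminorm_on (pointwise (*)) (weighted_space (topspace FK) TK \<nu> {norm}) ?n"
    and ne: "?n f = 0 \<Longrightarrow> f = 0"
    using Z f by (auto simp: Banach_on_def)
  have "0 \<le> ?n f" using sn f by (simp add: seminorm_on_def)
  then consider "?n f = 0" | "0 < ?n f" by linarith
  then show ?thesis
  proof cases
    case 1
    have "0 \<in> weighted_unit_ball FK TK \<nu>"
      using F.subspace_0[OF sub] seminorm_on_0[OF F.vector_space_axioms sub sn]
      by (simp add: weighted_unit_ball_def)
    with ne[OF 1] show ?thesis by (intro bexI[of _ 0]) auto
  next
    case 2
    let ?b = "pointwise (*) (of_real (1 / ?n f)) f"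
    have "?n ?b = norm (of_real (1 / ?n f) :: 'k) * ?n f"
      using sn f unfolding seminorm_on_def by blast
    then have "?b \<in> weighted_unit_ball FK TK \<nu>"
      using 2 F.subspace_scale[OF sub f] by (simp add: weighted_unit_ball_def norm_divide)
    moreover have "f = pointwise (*) (of_real (?n f)) ?b"
      using 2 by (simp add: pointwise_def)
    ultimately show ?thesis by blast
  qed
qed

lemma absolutely_convex_weighted_unit_ball:
  fixes TK :: "('o \<Rightarrow> 'k::real_normed_field) \<Rightarrow> 'w \<Rightarrow> 'k"
  assumes Z: "Banach_on (pointwise (*)) (weighted_space (topspace FK) TK \<nu> {norm}) (weighted_seminorm TK \<nu> norm)"
  shows "absolutely_convex (pointwise (*)) (weighted_unit_ball FK TK \<nu>)"
  unfolding absolutely_convex_def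
proof (intro ballI allI impI)
  interpret F: vector_space "pointwise (*) :: 'k \<Rightarrow> ('o \<Rightarrow> 'k) \<Rightarrow> _"
    by (rule vector_space_pointwise_field)
  let ?n = "weighted_seminorm TK \<nu> norm"
  fix f g :: "'o \<Rightarrow> 'k" and a b :: 'k
  assume fg: "f \<in> weighted_unit_ball FK TK \<nu>" "g \<in> weighted_unit_ball FK TK \<nu>" and ab: "norm a + norm b \<le> 1"
  have sub: "F.subspace (weighted_space (topspace FK) TK \<nu> {norm})"
    and sn: "seminorm_on (pointwise (*)) (weighted_space (topspace FK) TK \<nu> {norm}) ?n"
    using Z by (auto simp: Banach_on_def)
  have f: "f \<in> weighted_space (topspace FK) TK \<nu> {norm}" "?n f \<le> 1"
    and g: "g \<in> weighted_space (topspace FK) TK \<nu> {norm}" "?n g \<le> 1"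
    using fg by (auto simp: weighted_unit_ball_def)
  note ag = F.subspace_scale[OF sub f(1), of a] F.subspace_scale[OF sub g(1), of b]
  have "?n (pointwise (*) a f + pointwise (*) b g) \<le> ?n (pointwise (*) a f) + ?n (pointwise (*) b g)"
    using sn ag by (simp add: seminorm_on_def)
  also have "\<dots> = norm a * ?n f + norm b * ?n g" using sn f(1) g(1) by (simp add: seminorm_on_def)
  also have "\<dots> \<le> norm a * 1 + norm b * 1" using f(2) g(2) by (intro add_mono mult_left_mono) auto
  also have "\<dots> \<le> 1" using ab by simp
  finally show "pointwise (*) a f + pointwise (*) b g \<in> weighted_unit_ball FK TK \<nu>"
    using F.subspace_add[OF sub ag] by (simp add: weighted_unit_ball_def)
qed

text \<open>The equality of sets contains both that the restriction map takes values in the trace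
  space and that it is surjective.\<close>

theorem theorem5p2p68:
  fixes s :: "'k::real_or_complex \<Rightarrow> 'e::ab_group_add \<Rightarrow> 'e"
    and P :: "('e \<Rightarrow> real) set"
    and G :: "('e \<Rightarrow> 'k) set"
    and \<nu> :: "'w \<Rightarrow> real"
    and AP_K dom_K :: "('o \<Rightarrow> 'k) set"
    and AP_E dom_E :: "('o \<Rightarrow> 'e) set"
    and TK :: "('o \<Rightarrow> 'k) \<Rightarrow> 'w \<Rightarrow> 'k"
    and TE :: "('o \<Rightarrow> 'e) \<Rightarrow> 'w \<Rightarrow> 'e"
    and FK :: "('o \<Rightarrow> 'k) topology"
    and FE :: "('o \<Rightarrow> 'e) topology"
    and U :: "'w set"
  assumes "lcHs s P" and "locally_complete s P"
    and "separating_subspace s P G"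
    and "\<forall>x. 0 < \<nu> x"
    and "linear_map_on (pointwise (*)) (pointwise (*)) dom_K TK"
    and "linear_map_on (pointwise s) (pointwise s) dom_E TE"
    and "module.subspace (pointwise (*)) AP_K"
    and "module.subspace (pointwise s) AP_E"
    and "locally_convex_Hausdorff (pointwise (*)) (AP_K \<inter> dom_K) FK"
    and "locally_convex_Hausdorff (pointwise s) (AP_E \<inter> dom_E) FE"
    and "\<forall>x. point_eval FK x \<in> dual (pointwise (*)) FK"
    and "eps_into_compatible s P FK FE"
    and "generator s P \<nu> FK FE TE TK"
    and "strong s P FK FE TE TK" and "consistent s P FK FE TE TK"
    and "Banach_on (pointwise (*)) (weighted_space (topspace FK) TK \<nu> {norm})
           (weighted_seminorm TK \<nu> norm)"
    and "compactin FK (weighted_unit_ball FK TK \<nu>)"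
    and "fixes_topology FK TK \<nu> U"
  shows "restriction_map TE U ` weighted_eps_space s P \<nu> FK TK = weak_trace_space_lb s P \<nu> FK TK G U"
proof -
  interpret E: vector_space s using assms(1) by (simp add: lcHs_def)
  interpret F: vector_space "pointwise (*) :: 'k \<Rightarrow> ('o \<Rightarrow> 'k) \<Rightarrow> _"
    by (rule vector_space_pointwise_field)
  interpret D: vector_space "pointwise (*) :: 'k \<Rightarrow> (('o \<Rightarrow> 'k) \<Rightarrow> 'k) \<Rightarrow> _"
    by (rule vector_space_pointwise_field)
  note vs = E.vector_space_axioms and vF = F.vector_space_axioms
  have P: "directed_seminorms s UNIV P" using assms(1) by (simp add: lcHs_def)
  have sn: "seminorm_on s UNIV q" if "q \<in> P" for q using P that by (auto simp: directed_seminorms_def)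
  have "P \<noteq> {}" using P by (auto simp: directed_seminorms_def)
  then have topE: "topspace (seminorm_topology UNIV P) = UNIV"
    using topspace_seminorm_topology[OF vs E.subspace_UNIV] sn by blast
  have Gd: "e' \<in> dual s (seminorm_topology UNIV P)" if "e' \<in> G" for e'
    using assms(3) that by (auto simp: separating_subspace_def)
  have G_scale: "e' (s a x) = a * e' x" if "e' \<in> G" for e' a x
    using dual_scale[OF Gd[OF that]] by (simp add: topE)
  have subFK: "F.subspace (topspace FK)"
    using topspace_locally_convex_Hausdorff[OF vF assms(9)] by simp
  define Z where "Z = weighted_space (topspace FK) TK \<nu> {norm}"
  define B where "B = weighted_unit_ball FK TK \<nu>"
  let ?n = "weighted_seminorm TK \<nu> norm"
  note Z_scaled = weighted_unit_ball_scaled[OF assms(16), folded Z_def B_def]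
  have B: "compactin FK B" "absolutely_convex (pointwise (*)) B"
    using assms(17) absolutely_convex_weighted_unit_ball[OF assms(16)] by (simp_all add: B_def)
  have "0 \<in> Z" using assms(16) F.subspace_0 by (auto simp: Z_def Banach_on_def)
  then have B_ne: "B \<noteq> {}" using Z_scaled[of 0] by blast
  have BZ: "b \<in> Z" "?n b \<le> 1" if "b \<in> B" for b using that by (auto simp: B_def Z_def weighted_unit_ball_def)
  have ZF: "f \<in> topspace FK" if "f \<in> Z" for f using that by (auto simp: Z_def weighted_space_def)
  \<comment> \<open>\<open>consistent\<close> places \<open>op_eval FK TK x\<close> in the dual only
    under a quantifier over \<open>eps_maps\<close>; the zero map instantiates it.\<close>
  have "0 \<in> eps_maps (pointwise (*)) FK s P"
  proof -
    have "module.subspace (pointwise s) (eps_maps (pointwise (*)) FK s P)"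
      using assms(12) by (simp add: eps_into_compatible_def linear_map_on_def)
    then show ?thesis
      using module.subspace_0[OF module_vector_space[OF vector_space_pointwise[OF vs]]] by blast
  qed
  then have T_dual: "op_eval FK TK x \<in> dual (pointwise (*)) FK" for x
    using assms(15) by (auto simp: consistent_def)
  have T_eval: "op_eval FK TK x f = TK f x" if "f \<in> Z" for x f
    using ZF[OF that] by (simp add: op_eval_def zero_ext_def)
  \<comment> \<open>The functional \<open>\<nu>(x) T_x\<close>. On the weighted space its absolute
    values are the numbers whose supremum is the norm, so it lies in the polar of the unit
    ball.\<close>
  define \<tau> where "\<tau> x = pointwise (*) (of_real (\<nu> x)) (op_eval FK TK x)" for x
  have \<tau>_dual: "\<tau> x \<in> dual (pointwise (*)) FK" for x
    unfolding \<tau>_def by (rule D.subspace_scale[OF subspace_dual[OF vF subFK] T_dual])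
  have \<tau>_eval: "\<tau> x f = of_real (\<nu> x) * TK f x" if "f \<in> Z" for x f
    by (simp add: \<tau>_def pointwise_def T_eval[OF that])
  have norm_\<tau>: "norm (\<tau> x f) = norm (TK f x) * \<nu> x" if "f \<in> Z" for x f
    using assms(4)[rule_format, of x] by (simp add: \<tau>_eval[OF that] norm_mult)
  show ?thesis
  proof
    show "restriction_map TE U ` weighted_eps_space s P \<nu> FK TK \<subseteq> weak_trace_space_lb s P \<nu> FK TK G U"
    proof
      fix f assume "f \<in> restriction_map TE U ` weighted_eps_space s P \<nu> FK TK"
      then obtain u where u: "u \<in> eps_maps (pointwise (*)) FK s P"
          "bounded_wrt P (u ` dual_polar (pointwise (*)) FK B)"
        and f: "f = restrict (TE (S_map FK u)) U"
        by (auto simp: weighted_eps_space_def restriction_map_def B_def)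
      have Su: "S_map FK u \<in> topspace FE" and TE: "TE (S_map FK u) x = u (op_eval FK TK x)" for x
        using assms(15) u(1) by (auto simp: consistent_def)
      have \<tau>_polar: "\<tau> x \<in> dual_polar (pointwise (*)) FK B" for x
      proof -
        have "norm (\<tau> x b) \<le> 1" if "b \<in> B" for b
          using weighted_value_le[of b "topspace FK" TK \<nu> x] BZ[OF that] norm_\<tau>[of b x]
          by (simp add: Z_def)
        then show ?thesis using \<tau>_dual by (simp add: dual_polar_def)
      qed
      have u_\<tau>: "u (\<tau> x) = s (of_real (\<nu> x)) (TE (S_map FK u) x)" for x
        using u(1) T_dual[of x] topspace_kappa_dual[OF vF subFK] unfolding TE \<tau>_def
        by (simp add: eps_maps_def continuous_linear_maps_def linear_map_on_def)
      have "bounded_wrt P ((\<lambda>x. s (of_real (\<nu> x)) (f x)) ` U)"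
        unfolding bounded_wrt_def
      proof
        fix q assume "q \<in> P"
        then obtain M where M: "\<And>x. x \<in> u ` dual_polar (pointwise (*)) FK B \<Longrightarrow> q x \<le> M"
          using u(2) unfolding bounded_wrt_def by blast
        have "q (s (of_real (\<nu> x)) (f x)) \<le> M" if "x \<in> U" for x
          using M[OF imageI[OF \<tau>_polar[of x]]] that by (simp add: f u_\<tau>)
        then show "\<exists>M. \<forall>x\<in>(\<lambda>x. s (of_real (\<nu> x)) (f x)) ` U. q x \<le> M" by blast
      qed
      \<comment> \<open>The representing function is \<open>e'\<close> composed with
        \<open>S_map FK u\<close>. Strength of the family computes its image under
        \<open>TK\<close>, and boundedness of \<open>u\<close> on the polar, which contains every
        \<open>\<tau> x\<close>, makes its weighted norm finite.\<close>
      moreover have "\<exists>g\<in>Z. \<forall>x\<in>U. TK g x = (e' \<circ> f) x" if e': "e' \<in> G" for e'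
      proof (intro bexI[of _ "e' \<circ> S_map FK u"] ballI)
        have str: "e' \<circ> S_map FK u \<in> topspace FK"
            "TK (e' \<circ> S_map FK u) x = e' (TE (S_map FK u) x)" for x
          using assms(14) Gd[OF e'] Su unfolding strong_def by auto
        then show "TK (e' \<circ> S_map FK u) x = (e' \<circ> f) x" if "x \<in> U" for x
          using that by (simp add: f)
        obtain q c where q: "q \<in> P" "0 < c" "\<And>x. norm (e' x) \<le> c * q x"
          using dual_bound[OF vs P Gd[OF e']] by blast
        obtain M where M: "\<And>x. x \<in> u ` dual_polar (pointwise (*)) FK B \<Longrightarrow> q x \<le> M"
          using u(2) q(1) unfolding bounded_wrt_def by blast
        have "norm (TK (e' \<circ> S_map FK u) x) * \<nu> x \<le> c * M" for x
        proof -
          have "norm (TK (e' \<circ> S_map FK u) x) * \<nu> x = norm (e' (u (\<tau> x)))"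
            using assms(4)[rule_format, of x] by (simp add: str u_\<tau> G_scale[OF e'] norm_mult)
          also have "\<dots> \<le> c * q (u (\<tau> x))" by (rule q(3))
          also have "\<dots> \<le> c * M" using M[OF imageI[OF \<tau>_polar]] q(2) by (simp add: mult_left_mono)
          finally show ?thesis .
        qed
        then show "e' \<circ> S_map FK u \<in> Z"
          using str(1) by (auto simp: Z_def weighted_space_def intro!: bdd_aboveI[of _ "c * M"])
      qed
      ultimately show "f \<in> weak_trace_space_lb s P \<nu> FK TK G U"
        by (simp add: weak_trace_space_lb_def weak_trace_space_def f Z_def)
    qed
    show "weak_trace_space_lb s P \<nu> FK TK G U \<subseteq> restriction_map TE U ` weighted_eps_space s P \<nu> FK TK"
    proof
      fix f assume f: "f \<in> weak_trace_space_lb s P \<nu> FK TK G U"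
      have "\<exists>M. \<forall>x\<in>U. q (s (of_real (\<nu> x)) (f x)) \<le> M" if "q \<in> P" for q
        using f that by (auto simp: weak_trace_space_lb_def bounded_wrt_def)
      then obtain M0 where M0: "\<And>q x. \<lbrakk>q \<in> P; x \<in> U\<rbrakk> \<Longrightarrow> q (s (of_real (\<nu> x)) (f x)) \<le> M0 q"
        by metis
      \<comment> \<open>If \<open>U\<close> is empty, \<open>M0 q\<close> is unconstrained and may
        be negative.\<close>
      define M where "M q = max 0 (M0 q)" for q
      have "\<exists>g. g \<in> Z \<and> (\<forall>x\<in>U. TK g x = e' (f x))" if "e' \<in> G" for e'
        using f that by (auto simp: weak_trace_space_lb_def weak_trace_space_def Z_def)
      then obtain \<gamma> where \<gamma>: "\<And>e'. e' \<in> G \<Longrightarrow> \<gamma> e' \<in> Z" "\<And>e' x. \<lbrakk>e' \<in> G; x \<in> U\<rbrakk> \<Longrightarrow> TK (\<gamma> e') x = e' (f x)"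
        by metis
      obtain C where C: "0 < C" "\<And>g. g \<in> Z \<Longrightarrow> ?n g \<le> C * Sup (insert 0 ((\<lambda>x. norm (TK g x) * \<nu> x) ` U))"
        using assms(18) by (auto simp: fixes_topology_def Z_def)
      have "\<exists>u\<in>eps_maps (pointwise (*)) FK s P.
          (\<forall>y\<in>dual (pointwise (*)) FK. \<forall>e'\<in>G. e' (u y) = y (\<gamma> e')) \<and>
          bounded_wrt P (u ` dual_polar (pointwise (*)) FK B)"
      proof (rule weak_extension_eps_map[OF vs P assms(2) _ vF subFK B B_ne assms(3) _ C(1)])
        show "0 \<le> M q" for q by (simp add: M_def)
        show "\<exists>r b. b \<in> B \<and> \<gamma> e' = pointwise (*) (of_real r) b" if "e' \<in> G" for e'
          using Z_scaled[OF \<gamma>(1)[OF that]] by blast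
        \<comment> \<open>Since \<open>U\<close> fixes the topology, the norm of \<open>b\<close> is
          at most \<open>C\<close> times a supremum over \<open>U\<close>. A nearly maximal
          \<open>x\<close> gives the functional \<open>\<tau> x\<close>, represented by
          \<open>\<nu>(x) f(x)\<close>.\<close>
        fix b y and \<epsilon> :: real assume b: "b \<in> B" and \<epsilon>: "0 < \<epsilon>" and y: "y \<in> dual_polar (pointwise (*)) FK B"
        let ?S = "insert 0 ((\<lambda>x. norm (TK b x) * \<nu> x) ` U)"
        \<comment> \<open>Membership in the polar gives only \<open>norm (y b) \<le> 1\<close>;
          passing to the normalised \<open>b'\<close> sharpens the bound to the norm of
          \<open>b\<close>.\<close>
        obtain b' where b': "b' \<in> B" "b = pointwise (*) (of_real (?n b)) b'"
          using Z_scaled[OF BZ(1)[OF b]] by blast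
        have "y b = of_real (?n b) * y b'"
          using y by (subst b'(2), intro dual_scale[where X = FK] ZF BZ(1) b'(1)) (simp add: dual_polar_def)
        moreover have "norm (y b') \<le> 1" using y b'(1) by (simp add: dual_polar_def)
        moreover have n0: "0 \<le> ?n b" using assms(16) BZ(1)[OF b] by (simp add: Banach_on_def seminorm_on_def Z_def)
        ultimately have "norm (y b) \<le> ?n b" by (simp add: norm_mult mult_left_le)
        also have "\<dots> \<le> C * Sup ?S" by (rule C(2)[OF BZ(1)[OF b]])
        finally have le: "norm (y b) \<le> C * Sup ?S" .
        have bdd: "bdd_above ?S"
          using weighted_value_le[of b "topspace FK" TK \<nu>] BZ(1)[OF b] n0
          by (intro bdd_aboveI[of _ "?n b"]) (auto simp: Z_def)
        have "Sup ?S - \<epsilon> / C < Sup ?S" using \<epsilon> C(1) by simp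
        then obtain a where a: "a \<in> ?S" "Sup ?S - \<epsilon> / C < a"
          using less_cSup_iff[OF _ bdd] by blast
        have "C * Sup ?S \<le> C * a + \<epsilon>"
          using a(2) C(1) by (simp add: field_simps)
        with le have le': "norm (y b) \<le> C * a + \<epsilon>" by simp
        show "\<exists>z\<in>dual (pointwise (*)) FK. (\<exists>d. (\<forall>q\<in>P. q d \<le> M q) \<and> (\<forall>e'\<in>G. e' d = z (\<gamma> e'))) \<and>
            norm (y b) \<le> C * norm (z b) + \<epsilon>"
        \<comment> \<open>The value 0 may be just the element inserted into \<open>?S\<close>, with
          no point of \<open>U\<close> behind it. The zero functional, represented by 0, then
          suffices.\<close>
        proof (cases "a = 0")
          case True
          have "q 0 \<le> M q" if "q \<in> P" for q
            using seminorm_on_0[OF vs E.subspace_UNIV sn[OF that]] by (simp add: M_def)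
          then have "(\<forall>q\<in>P. q 0 \<le> M q) \<and> (\<forall>e'\<in>G. e' 0 = (0 :: ('o \<Rightarrow> 'k) \<Rightarrow> 'k) (\<gamma> e'))"
            using dual_0[OF vs Gd] by simp
          then show ?thesis
            using le' True D.subspace_0[OF subspace_dual[OF vF subFK]] by (intro bexI[of _ 0]) auto
        next
          case False
          then obtain x where x: "x \<in> U" "a = norm (\<tau> x b)"
            using a(1) norm_\<tau>[OF BZ(1)[OF b]] by auto
          have "\<forall>q\<in>P. q (s (of_real (\<nu> x)) (f x)) \<le> M q"
            using M0 x(1) by (auto simp: M_def le_max_iff_disj)
          moreover have "\<forall>e'\<in>G. e' (s (of_real (\<nu> x)) (f x)) = \<tau> x (\<gamma> e')"
            using \<gamma> x(1) by (simp add: \<tau>_eval G_scale)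
          ultimately show ?thesis using \<tau>_dual le' x(2) by blast
        qed
      qed
      then obtain u where u: "u \<in> eps_maps (pointwise (*)) FK s P"
          "\<And>y e'. \<lbrakk>y \<in> dual (pointwise (*)) FK; e' \<in> G\<rbrakk> \<Longrightarrow> e' (u y) = y (\<gamma> e')"
          "bounded_wrt P (u ` dual_polar (pointwise (*)) FK B)"
        by blast
      \<comment> \<open>Each \<open>e'\<close> in \<open>G\<close> takes the same value at
        \<open>u (op_eval FK TK x)\<close> and at \<open>f x\<close>, namely
        \<open>TK (\<gamma> e') x\<close>. Separation identifies the two vectors, and consistency
        identifies the first with \<open>TE (S_map FK u) x\<close>.\<close>
      have "TE (S_map FK u) x = f x" if "x \<in> U" for x
      proof -
        have "e' (u (op_eval FK TK x) - f x) = 0" if e': "e' \<in> G" for e'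
          using dual_diff[OF vs Gd[OF e']] u(2)[OF T_dual e'] T_eval[OF \<gamma>(1)[OF e']] \<gamma>(2)[OF e' \<open>x \<in> U\<close>]
          by (simp add: topE)
        then have "u (op_eval FK TK x) - f x = 0"
          using assms(3) unfolding separating_subspace_def by blast
        then show ?thesis using assms(15) u(1) by (simp add: consistent_def)
      qed
      moreover have "f \<in> extensional U" using f by (simp add: weak_trace_space_lb_def weak_trace_space_def)
      ultimately have "f = restriction_map TE U (S_map FK u)"
        unfolding restriction_map_def by (intro extensionalityI[of _ U]) auto
      moreover have "S_map FK u \<in> weighted_eps_space s P \<nu> FK TK"
        using u(1,3) by (auto simp: weighted_eps_space_def B_def)
      ultimately show "f \<in> restriction_map TE U ` weighted_eps_space s P \<nu> FK TK" by blast
    qed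
  qed
qed

end
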